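(* Let $m=n$ and let ${\bf f}$ be generic, so that $V_{\bf f}$ is finite. Let $x\neq x'$ be two points of $V_{\bf f}$, let $S_x=x-\tfrac12\mathrm{Jac}_{\bf f}(x)\cdot\mathrm{S}^{ed}_{\bf f}$ and $S_{x'}=x'-\tfrac12\mathrm{Jac}_{\bf f}(x')\cdot\mathrm{S}^{ed}_{\bf f}$, and let $\mathrm{bsc}\subset\mathbb{R}^n$ be the bisector hyperplane of $x$ and $x'$ (the set of points equidistant from $x$ and $x'$). Then there is a point $u\in\mathbb{R}^n$ at which the three hypersurfaces $\mathrm{bsc}$, $\partial_{\rm alg}S_x$ and $\partial_{\rm alg}S_{x'}$ meet tangentially.
   Context: ${\bf f}=(f_1,\dots,f_n)$ with $f_i(x)=x^TA_ix+2a_i^Tx+\alpha_i$ ($A_i$ real symmetric $n\times n$, $a_i\in\mathbb{R}^n$, $\alpha_i\in\mathbb{R}$), $V_{\bf f}=\{x\in\mathbb{R}^n:f_i(x)=0\ \forall i\}$, $\mathrm{Jac}_{\bf f}(x)$ the $n\times n$ Jacobian with $(i,j)$ entry $\partial f_j/\partial x_i$, and $\mathrm{S}^{ed}_{\bf f}=\{\lambda\in\mathbb{R}^n:\sum_i\lambda_iA_i\prec I_n\}$. $\partial_{\rm alg}S$ denotes the algebraic boundary (Zariski closure of the topological boundary) of $S$. *)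

theory Defs
  imports "HOL-Analysis.Analysis"
begin

inductive_set polyfun :: "('a::euclidean_space \<Rightarrow> real) set" where
  pf_const: "(\<lambda>x. c) \<in> polyfun"
| pf_coord: "b \<in> Basis \<Longrightarrow> (\<lambda>x. x \<bullet> b) \<in> polyfun"
| pf_add: "p \<in> polyfun \<Longrightarrow> q \<in> polyfun \<Longrightarrow> (\<lambda>x. p x + q x) \<in> polyfun"
| pf_mult: "p \<in> polyfun \<Longrightarrow> q \<in> polyfun \<Longrightarrow> (\<lambda>x. p x * q x) \<in> polyfun"

definition vanishing_ideal :: "'a::euclidean_space set \<Rightarrow> ('a \<Rightarrow> real) set" where
  "vanishing_ideal S = {p \<in> polyfun. \<forall>y\<in>S. p y = 0}"

definition zariski_closure :: "'a::euclidean_space set \<Rightarrow> 'a set" where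
  "zariski_closure S = {x. \<forall>p\<in>vanishing_ideal S. p x = 0}"

definition alg_boundary :: "'a::euclidean_space set \<Rightarrow> 'a set" where
  "alg_boundary S = zariski_closure (frontier S)"

definition zariski_tangent :: "'a::euclidean_space set \<Rightarrow> 'a \<Rightarrow> 'a set" where
  "zariski_tangent Z u = {v. \<forall>p\<in>vanishing_ideal Z. frechet_derivative p (at u) v = 0}"

definition smooth_hypersurface_point :: "'a::euclidean_space set \<Rightarrow> 'a \<Rightarrow> bool" where
  "smooth_hypersurface_point Z u \<longleftrightarrow> u \<in> Z \<and> dim (zariski_tangent Z u) = DIM('a) - 1"

definition meet_tangentially :: "'a::euclidean_space set set \<Rightarrow> 'a \<Rightarrow> bool" where
  "meet_tangentially Hs u \<longleftrightarrow>
     (\<forall>Z\<in>Hs. smooth_hypersurface_point Z u) \<and>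
     (\<forall>Z\<in>Hs. \<forall>Z'\<in>Hs. zariski_tangent Z u = zariski_tangent Z' u)"

text \<open>Data of f = (f_1,...,f_n): matrices A_i, vectors a_i, scalars alpha_i, indexed by 'n.\<close>
type_synonym 'n qdata = "((real^'n^'n)^'n) \<times> ((real^'n)^'n) \<times> (real^'n)"

definition qA :: "'n::finite qdata \<Rightarrow> 'n \<Rightarrow> real^'n^'n" where "qA P i = fst P $ i"
definition qa :: "'n::finite qdata \<Rightarrow> 'n \<Rightarrow> real^'n" where "qa P i = fst (snd P) $ i"
definition qalpha :: "'n::finite qdata \<Rightarrow> 'n \<Rightarrow> real" where "qalpha P i = snd (snd P) $ i"

definition symmetric_data :: "'n::finite qdata \<Rightarrow> bool" where
  "symmetric_data P \<longleftrightarrow> (\<forall>i. transpose (qA P i) = qA P i)"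

definition qf :: "'n::finite qdata \<Rightarrow> 'n \<Rightarrow> real^'n \<Rightarrow> real" where
  "qf P i x = x \<bullet> (qA P i *v x) + 2 * (qa P i \<bullet> x) + qalpha P i"

definition Vf :: "'n::finite qdata \<Rightarrow> (real^'n) set" where
  "Vf P = {x. \<forall>i. qf P i x = 0}"

definition Jacf :: "'n::finite qdata \<Rightarrow> real^'n \<Rightarrow> real^'n^'n" where
  "Jacf P x = (\<chi> i j. frechet_derivative (qf P j) (at x) (axis i 1))"

definition loewner_less :: "real^'n^'n \<Rightarrow> real^'n^'n \<Rightarrow> bool" where
  "loewner_less A B \<longleftrightarrow> (\<forall>v::real^'n. v \<noteq> 0 \<longrightarrow> v \<bullet> ((B - A) *v v) > 0)"

definition Sed :: "'n::finite qdata \<Rightarrow> (real^'n) set" where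
  "Sed P = {l. loewner_less (\<Sum>i\<in>UNIV. l $ i *\<^sub>R qA P i) (mat 1)}"

definition Sx :: "'n::finite qdata \<Rightarrow> real^'n \<Rightarrow> (real^'n) set" where
  "Sx P x = {x - (1/2) *\<^sub>R (Jacf P x *v l) | l. l \<in> Sed P}"

definition bisector :: "real^'n \<Rightarrow> real^'n \<Rightarrow> (real^'n) set" where
  "bisector x x' = {u. dist u x = dist u x'}"

text \<open>A property holds for generic f: it holds on a nonempty Zariski-open subset of the
  (linear) space of data with symmetric A_i, i.e. off the zero set of a polynomial
  function on the data space which does not vanish identically on symmetric data.\<close>
definition generic_qdata :: "('n::finite qdata \<Rightarrow> bool) \<Rightarrow> bool" where
  "generic_qdata Prop \<longleftrightarrow>
     (\<exists>g\<in>polyfun. (\<exists>P. symmetric_data P \<and> g P \<noteq> 0) \<and>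
        (\<forall>P. symmetric_data P \<and> g P \<noteq> 0 \<longrightarrow> Prop P))"

end

(* For d = x' - x and x, x' in V_f one has d . (A_j x + a_j) = - d . (A_j d) / 2, so under the
   affine map l |-> x - Jac(x) l / 2 the bisector becomes d . ((I - A(l)) d) = 0, where
   A(l) = sum_i l_i A_i.  Hence the tangency point is the image u of the solution l of A(l) d = d,
   which is the same point for x and x'.

   Since m = n, the hypersurface det (I - A(l)) = 0 is rationally parametrized by kernel vectors:
   v |-> l(v), the solution of A(l) v = v, given by Cramer's rule.  If one boundary point of the
   spectrahedron has a one-dimensional kernel spanned by a v with [A_1 v ... A_n v] invertible, then
   l(v) stays in the boundary for v in an open set, so a polynomial vanishing on the boundary
   vanishes at all l(v).  This replaces irreducibility of the determinant, and differentiating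
   along l(v) at v = d gives the tangent space.

   Each degenerate set of data is covered by a polynomial map that depends on fewer parameters than
   the space of symmetric data has coordinates.  Such an image lies in a proper hypersurface because
   there are more monomials of bounded degree in the target than in the source. *)

theory Submission
  imports Defs "HOL-Computational_Algebra.Polynomial"
begin

section \<open>Polynomial functions\<close>

text \<open>The obstacle is that I - A(l) may be indefinite at the tangency point, which then lies
  in the Zariski closure of the boundary but not on the boundary itself. Everything is therefore
  transported from one explicit boundary point, e_m / t, where t is an eigenvalue of largest modulus
  of a single matrix A_m. The points obtained from x and x' coincide because b_j = A_j x + a_j
  changes by A_j d, so the two images differ by d - A(l) d. They are tangent because the
  differential of det (I - A) at l has kernel {h. d . (A(h) d) = 0} when d spans the kernel of I -
  A(l), and this is also the direction space of the pulled-back bisector. Genericity has to supply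
  five facts: the b_j are independent, the A_j d are independent, the kernel of I - A(l) is a line,
  and for A_m the analogues of the last two at eigenvectors. The first three quantify over unknown
  zeros. Coordinates of x replace the \<alpha>_j, and the direction of d occupies the slots released
  by f_j(x') = 0, so the count of parameters still closes.\<close>

lemma polyfun_sum:
  "(\<And>i. i \<in> S \<Longrightarrow> f i \<in> polyfun) \<Longrightarrow> (\<lambda>x. \<Sum>i\<in>S. f i x) \<in> polyfun"
  by (induction S rule: infinite_finite_induct) (simp_all add: pf_const pf_add)

lemma polyfun_prod:
  "(\<And>i. i \<in> S \<Longrightarrow> f i \<in> polyfun) \<Longrightarrow> (\<lambda>x. \<Prod>i\<in>S. f i x) \<in> polyfun"
  by (induction S rule: infinite_finite_induct) (simp_all add: pf_const pf_mult)

lemma polyfun_diff: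
  assumes "f \<in> polyfun" "g \<in> polyfun" shows "(\<lambda>x. f x - g x) \<in> polyfun"
  using pf_add[OF assms(1) pf_mult[OF pf_const[of "-1"] assms(2)]] by simp

lemma polyfun_linear:
  fixes f :: "'a::euclidean_space \<Rightarrow> real"
  assumes "linear f" shows "f \<in> polyfun"
proof -
  have "f = (\<lambda>x. \<Sum>b\<in>Basis. (x \<bullet> b) * f b)"
  proof
    fix x
    have "f x = f (\<Sum>b\<in>Basis. (x \<bullet> b) *\<^sub>R b)" by (simp add: euclidean_representation)
    also have "\<dots> = (\<Sum>b\<in>Basis. (x \<bullet> b) * f b)"
      using assms by (simp add: linear_sum linear_cmul)
    finally show "f x = (\<Sum>b\<in>Basis. (x \<bullet> b) * f b)" .
  qed
  moreover have "(\<lambda>x. \<Sum>b\<in>Basis. (x \<bullet> b) * f b) \<in> polyfun"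
    by (intro polyfun_sum pf_mult pf_coord pf_const)
  ultimately show ?thesis by simp
qed

lemma polyfun_compose:
  assumes "p \<in> polyfun" "\<And>b. b \<in> Basis \<Longrightarrow> (\<lambda>x. \<phi> x \<bullet> b) \<in> polyfun"
  shows "(\<lambda>x. p (\<phi> x)) \<in> polyfun"
  using assms(1) by induction (auto intro: polyfun.intros assms(2))

lemma polyfun_differentiable:
  assumes "p \<in> polyfun" shows "p differentiable (at x)"
  using assms by induction (auto intro!: derivative_intros simp: differentiable_def)

lemma polyfun_has_derivative:
  assumes "p \<in> polyfun" shows "(p has_derivative frechet_derivative p (at x)) (at x)"
  using polyfun_differentiable[OF assms] frechet_derivative_works by blast

lemma polyfun_continuous: "p \<in> polyfun \<Longrightarrow> isCont p x"
  using polyfun_differentiable differentiable_imp_continuous_within by blast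

lemma polyfun_line:
  assumes "p \<in> polyfun" shows "\<exists>q::real poly. \<forall>t. p (a + t *\<^sub>R b) = poly q t"
  using assms
proof induction
  case (pf_const c)
  then show ?case by (intro exI[of _ "[:c:]"]) auto
next
  case (pf_coord e)
  then show ?case
    by (intro exI[of _ "[:a \<bullet> e, b \<bullet> e:]"]) (auto simp: inner_simps)
next
  case (pf_add p q)
  then show ?case by (metis poly_add)
next
  case (pf_mult p q)
  then show ?case by (metis poly_mult)
qed

text \<open>Restricted to the line through \<open>a\<close> and \<open>b\<close>, both factors are
  nonzero univariate polynomials. Staying on this line matters: between two symmetric data it
  consists of symmetric data, as \<open>generic_conj\<close> requires.\<close>

lemma polyfun_mult_nonzero:
  assumes "p \<in> polyfun" "q \<in> polyfun" "p a \<noteq> 0" "q b \<noteq> 0"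
  shows "\<exists>t. p (a + t *\<^sub>R (b - a)) * q (a + t *\<^sub>R (b - a)) \<noteq> 0"
proof -
  obtain P Q :: "real poly" where P: "\<And>t. p (a + t *\<^sub>R (b - a)) = poly P t"
    and Q: "\<And>t. q (a + t *\<^sub>R (b - a)) = poly Q t"
    using polyfun_line[OF assms(1)] polyfun_line[OF assms(2)] by metis
  have "P \<noteq> 0" using P[of 0] assms(3) by auto
  moreover have "Q \<noteq> 0" using Q[of 1] assms(4) by auto
  ultimately have "P * Q \<noteq> 0" by simp
  then obtain t where "poly (P * Q) t \<noteq> 0" using poly_all_0_iff_0 by blast
  then show ?thesis using P Q by auto
qed

text \<open>On the line from \<open>a\<close> to an arbitrary \<open>x\<close> the restriction has
  infinitely many roots near parameter 0.\<close>

lemma polyfun_open_zero: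
  fixes p :: "'a::euclidean_space \<Rightarrow> real"
  assumes p: "p \<in> polyfun" and S: "open S" "a \<in> S" "\<And>x. x \<in> S \<Longrightarrow> p x = 0"
  shows "p x = 0"
proof -
  obtain q :: "real poly" where q: "\<And>t. p (a + t *\<^sub>R (x - a)) = poly q t"
    using polyfun_line[OF p] by metis
  have "((\<lambda>t. a + t *\<^sub>R (x - a)) \<longlongrightarrow> a + 0 *\<^sub>R (x - a)) (at (0::real))"
    by (intro tendsto_intros)
  then have "eventually (\<lambda>t. a + t *\<^sub>R (x - a) \<in> S) (at (0::real))"
    using S topological_tendstoD by fastforce
  then have "eventually (\<lambda>t. poly q t = 0) (at (0::real))"
    by eventually_elim (use q S in metis)
  then obtain d where d: "d > 0" "\<And>t. t \<noteq> 0 \<Longrightarrow> dist t 0 < d \<Longrightarrow> poly q t = 0"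
    unfolding eventually_at by auto
  have "{0<..<d} \<subseteq> {t. poly q t = 0}" using d by auto
  moreover have "infinite {0<..<d}" using d by (simp add: infinite_Ioo)
  ultimately have "q = 0" using poly_roots_finite infinite_super by blast
  then show ?thesis using q[of 1] by simp
qed

text \<open>A second notion of polynomial, over an arbitrary index type, in which \<open>J\<close>
  records the variables that may occur. Counting parameters then means comparing cardinalities of
  index sets.\<close>

inductive_set multipoly :: "'v set \<Rightarrow> (('v \<Rightarrow> real) \<Rightarrow> real) set" for J where
  multipoly_const: "(\<lambda>y. c) \<in> multipoly J"
| multipoly_var: "i \<in> J \<Longrightarrow> (\<lambda>y. y i) \<in> multipoly J"
| multipoly_add: "f \<in> multipoly J \<Longrightarrow> g \<in> multipoly J \<Longrightarrow> (\<lambda>y. f y + g y) \<in> multipoly J"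
| multipoly_mult: "f \<in> multipoly J \<Longrightarrow> g \<in> multipoly J \<Longrightarrow> (\<lambda>y. f y * g y) \<in> multipoly J"

lemma multipoly_uminus: "f \<in> multipoly J \<Longrightarrow> (\<lambda>y. - f y) \<in> multipoly J"
  using multipoly_mult[OF multipoly_const[of "-1"], of f J] by simp

lemma multipoly_diff: "f \<in> multipoly J \<Longrightarrow> g \<in> multipoly J \<Longrightarrow> (\<lambda>y. f y - g y) \<in> multipoly J"
  using multipoly_add[OF _ multipoly_uminus, of f J g] by simp

lemma multipoly_sum: "(\<And>i. i \<in> S \<Longrightarrow> f i \<in> multipoly J) \<Longrightarrow> (\<lambda>y. \<Sum>i\<in>S. f i y) \<in> multipoly J"
  by (induction S rule: infinite_finite_induct) (simp_all add: multipoly_const multipoly_add)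

lemma multipoly_power: "f \<in> multipoly J \<Longrightarrow> (\<lambda>y. f y ^ k) \<in> multipoly J"
  by (induction k) (auto intro: multipoly.intros)

lemma multipoly_prod: "(\<And>i. i \<in> S \<Longrightarrow> f i \<in> multipoly J) \<Longrightarrow> (\<lambda>y. \<Prod>i\<in>S. f i y) \<in> multipoly J"
  by (induction S rule: infinite_finite_induct) (simp_all add: multipoly_const multipoly_mult)

lemma multipoly_if: "(b \<Longrightarrow> f \<in> multipoly J) \<Longrightarrow> (\<not> b \<Longrightarrow> g \<in> multipoly J) \<Longrightarrow> (\<lambda>y. if b then f y else g y) \<in> multipoly J"
  by (cases b) auto

definition monomial_fun :: "'v set \<Rightarrow> ('v \<Rightarrow> nat) \<Rightarrow> ('v \<Rightarrow> real) \<Rightarrow> real" where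
  "monomial_fun J m y = (\<Prod>i\<in>J. y i ^ m i)"

text \<open>\<open>D\<close> bounds each exponent separately rather than the total degree, so that
  there are exactly (D + 1) ^ |J| monomials.\<close>

definition poldeg :: "'v set \<Rightarrow> nat \<Rightarrow> (('v \<Rightarrow> real) \<Rightarrow> real) set" where
  "poldeg J D = {f. \<exists>c. \<forall>y. f y = (\<Sum>m\<in>J \<rightarrow>\<^sub>E {..D}. c m * monomial_fun J m y)}"

lemma poldeg_add:
  assumes "f \<in> poldeg J D" "g \<in> poldeg J D" shows "(\<lambda>y. f y + g y) \<in> poldeg J D"
proof -
  obtain c d where "\<And>y. f y = (\<Sum>m\<in>J \<rightarrow>\<^sub>E {..D}. c m * monomial_fun J m y)"
    "\<And>y. g y = (\<Sum>m\<in>J \<rightarrow>\<^sub>E {..D}. d m * monomial_fun J m y)"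
    using assms unfolding poldeg_def by blast
  then show ?thesis unfolding poldeg_def
    by (auto intro!: exI[of _ "\<lambda>m. c m + d m"] simp: sum.distrib algebra_simps)
qed

lemma poldeg_cmult:
  assumes "f \<in> poldeg J D" shows "(\<lambda>y. k * f y) \<in> poldeg J D"
proof -
  obtain c where "\<And>y. f y = (\<Sum>m\<in>J \<rightarrow>\<^sub>E {..D}. c m * monomial_fun J m y)"
    using assms unfolding poldeg_def by blast
  then show ?thesis unfolding poldeg_def
    by (auto intro!: exI[of _ "\<lambda>m. k * c m"] simp: sum_distrib_left algebra_simps)
qed

lemma poldeg_zero: "(\<lambda>y. 0) \<in> poldeg J D"
  unfolding poldeg_def by (auto intro!: exI[of _ "\<lambda>m. 0"])

lemma poldeg_sum: "(\<And>i. i \<in> S \<Longrightarrow> f i \<in> poldeg J D) \<Longrightarrow> (\<lambda>y. \<Sum>i\<in>S. f i y) \<in> poldeg J D"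
  by (induction S rule: infinite_finite_induct) (simp_all add: poldeg_zero poldeg_add)

lemma poldeg_monomial:
  assumes "finite J" "\<And>i. i \<in> J \<Longrightarrow> m i \<le> D" shows "monomial_fun J m \<in> poldeg J D"
proof -
  have r: "restrict m J \<in> J \<rightarrow>\<^sub>E {..D}" using assms by auto
  have f: "finite (J \<rightarrow>\<^sub>E {..D})" using assms by (simp add: finite_PiE)
  have "monomial_fun J m y = (\<Sum>m'\<in>J \<rightarrow>\<^sub>E {..D}. (if m' = restrict m J then 1 else 0) * monomial_fun J m' y)" for y
  proof -
    have "(\<Sum>m'\<in>J \<rightarrow>\<^sub>E {..D}. (if m' = restrict m J then 1 else 0) * monomial_fun J m' y)
        = (\<Sum>m'\<in>J \<rightarrow>\<^sub>E {..D}. (if m' = restrict m J then monomial_fun J m' y else 0))"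
      by (intro sum.cong) auto
    also have "\<dots> = monomial_fun J (restrict m J) y"
      using r f by (simp add: sum.delta)
    also have "\<dots> = monomial_fun J m y" unfolding monomial_fun_def by (intro prod.cong) auto
    finally show ?thesis by simp
  qed
  then show ?thesis unfolding poldeg_def by (intro CollectI exI allI)
qed

lemma poldeg_mono:
  assumes "finite J" "D \<le> D'" "f \<in> poldeg J D" shows "f \<in> poldeg J D'"
proof -
  obtain c where c: "\<And>y. f y = (\<Sum>m\<in>J \<rightarrow>\<^sub>E {..D}. c m * monomial_fun J m y)"
    using assms unfolding poldeg_def by blast
  have "(\<lambda>y. \<Sum>m\<in>J \<rightarrow>\<^sub>E {..D}. c m * monomial_fun J m y) \<in> poldeg J D'"
    using assms(1,2) by (intro poldeg_sum poldeg_cmult poldeg_monomial) (auto dest!: PiE_mem)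
  then show ?thesis using c by presburger
qed

lemma poldeg_mult:
  assumes J: "finite J" and "f \<in> poldeg J D" "g \<in> poldeg J E"
  shows "(\<lambda>y. f y * g y) \<in> poldeg J (D + E)"
proof -
  obtain c d where f: "\<And>y. f y = (\<Sum>m\<in>J \<rightarrow>\<^sub>E {..D}. c m * monomial_fun J m y)"
    and g: "\<And>y. g y = (\<Sum>m\<in>J \<rightarrow>\<^sub>E {..E}. d m * monomial_fun J m y)"
    using assms unfolding poldeg_def by blast
  have "f y * g y = (\<Sum>m\<in>J \<rightarrow>\<^sub>E {..D}. \<Sum>m'\<in>J \<rightarrow>\<^sub>E {..E}. (c m * d m') * monomial_fun J (\<lambda>i. m i + m' i) y)" for y
    unfolding f g sum_product monomial_fun_def
    by (intro sum.cong refl) (simp add: power_add prod.distrib algebra_simps)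
  moreover have "(\<lambda>y. \<Sum>m\<in>J \<rightarrow>\<^sub>E {..D}. \<Sum>m'\<in>J \<rightarrow>\<^sub>E {..E}. (c m * d m') * monomial_fun J (\<lambda>i. m i + m' i) y)
      \<in> poldeg J (D + E)"
    using J by (intro poldeg_sum poldeg_cmult poldeg_monomial) (auto dest!: PiE_mem intro: add_mono)
  ultimately show ?thesis by presburger
qed

lemma poldeg_const:
  assumes "finite J" shows "(\<lambda>y. k) \<in> poldeg J D"
proof -
  have "(\<lambda>y. k * monomial_fun J (\<lambda>_. 0) y) \<in> poldeg J D"
    using assms by (intro poldeg_cmult poldeg_monomial) auto
  then show ?thesis by (simp add: monomial_fun_def)
qed

lemma poldeg_power:
  assumes "finite J" "f \<in> poldeg J D" shows "(\<lambda>y. f y ^ k) \<in> poldeg J (k * D)"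
proof (induction k)
  case (Suc k)
  then show ?case using poldeg_mult[OF assms(1) assms(2) Suc] by simp
qed (use poldeg_const[OF assms(1)] in simp)

lemma poldeg_prod:
  assumes "finite J" "finite S" "\<And>i. i \<in> S \<Longrightarrow> f i \<in> poldeg J (d i)"
  shows "(\<lambda>y. \<Prod>i\<in>S. f i y) \<in> poldeg J (\<Sum>i\<in>S. d i)"
  using assms(2,3)
  by (induction S rule: finite_induct) (auto intro: poldeg_mult poldeg_const assms(1))

lemma multipoly_poldeg:
  assumes J: "finite J" and f: "f \<in> multipoly J" shows "\<exists>D. f \<in> poldeg J D"
  using f
proof induction
  case (multipoly_const c)
  then show ?case using poldeg_const[OF J] by blast
next
  case (multipoly_var i)
  have "monomial_fun J (\<lambda>j. if j = i then 1 else 0) \<in> poldeg J 1"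
    by (intro poldeg_monomial J) auto
  moreover have "monomial_fun J (\<lambda>j. if j = i then 1 else 0) = (\<lambda>y. y i)"
  proof
    fix y :: "'a \<Rightarrow> real"
    have "monomial_fun J (\<lambda>j. if j = i then 1 else 0) y = (\<Prod>j\<in>J. if j = i then y j else 1)"
      unfolding monomial_fun_def by (intro prod.cong) auto
    then show "monomial_fun J (\<lambda>j. if j = i then 1 else 0) y = y i"
      using J multipoly_var by (simp add: prod.delta)
  qed
  ultimately show ?case by auto
next
  case (multipoly_add f g)
  then obtain D E where "f \<in> poldeg J D" "g \<in> poldeg J E" by blast
  then have "f \<in> poldeg J (max D E)" "g \<in> poldeg J (max D E)"
    by (auto intro: poldeg_mono[OF J, rotated])
  then show ?case using poldeg_add by blast
next
  case (multipoly_mult f g)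
  then show ?case using poldeg_mult[OF J] by blast
qed

section \<open>Algebraic dependence by counting monomials\<close>

lemma homogeneous_system:
  fixes M :: "'e \<Rightarrow> 'u \<Rightarrow> real"
  assumes "finite E" "finite U" "card E < card U"
  shows "\<exists>c. (\<exists>u\<in>U. c u \<noteq> 0) \<and> (\<forall>e\<in>E. (\<Sum>u\<in>U. M e u * c u) = 0)"
  using assms
proof (induction E arbitrary: U M rule: finite_induct)
  case empty
  then obtain u where "u \<in> U" by fastforce
  then show ?case by (intro exI[of _ "\<lambda>_. 1"]) auto
next
  case (insert e E)
  show ?case
  proof (cases "\<forall>u\<in>U. M e u = 0")
    case True
    have "card E < card U" using insert by simp
    from insert.IH[OF insert.prems(1) this, of M] True show ?thesis by auto
  next
    case False
    then obtain u0 where u0: "u0 \<in> U" "M e u0 \<noteq> 0" by blast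
    have fin: "finite (U - {u0})" and c: "card E < card (U - {u0})"
      using insert u0 by auto
    obtain c where c: "\<exists>u\<in>U - {u0}. c u \<noteq> 0"
      "\<And>e'. e' \<in> E \<Longrightarrow> (\<Sum>u\<in>U - {u0}. (M e' u - M e' u0 * M e u / M e u0) * c u) = 0"
      using insert.IH[OF fin c, of "\<lambda>e' u. M e' u - M e' u0 * M e u / M e u0"] by blast
    \<comment> \<open>Gaussian elimination with pivot \<open>M e u0\<close>: this is the value of
      the unknown \<open>u0\<close> forced by equation \<open>e\<close>.\<close>
    define s where "s = - (\<Sum>u\<in>U - {u0}. M e u * c u) / M e u0"
    have split: "(\<Sum>u\<in>U. M e' u * (c(u0 := s)) u) = M e' u0 * s + (\<Sum>u\<in>U - {u0}. M e' u * c u)" for e'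
      by (subst sum.remove[OF insert.prems(1) u0(1)]) (auto intro!: sum.cong)
    show ?thesis
    proof (intro exI[of _ "c(u0 := s)"] conjI ballI)
      show "\<exists>u\<in>U. (c(u0 := s)) u \<noteq> 0" using c(1) by auto
      fix e' assume "e' \<in> insert e E"
      then consider "e' = e" | "e' \<in> E" by blast
      then show "(\<Sum>u\<in>U. M e' u * (c(u0 := s)) u) = 0"
      proof cases
        case 1
        then show ?thesis unfolding split using u0 by (simp add: s_def)
      next
        case 2
        have "(\<Sum>u\<in>U - {u0}. (M e' u - M e' u0 * M e u / M e u0) * c u)
          = (\<Sum>u\<in>U - {u0}. M e' u * c u) - (\<Sum>u\<in>U - {u0}. (M e' u0 / M e u0) * (M e u * c u))"
          unfolding sum_subtractf[symmetric] by (intro sum.cong) (auto simp: algebra_simps)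
        also have "\<dots> = (\<Sum>u\<in>U - {u0}. M e' u * c u) + M e' u0 * s"
          unfolding sum_distrib_left[symmetric] s_def by simp
        finally show ?thesis unfolding split using c(2)[OF 2] by simp
      qed
    qed
  qed
qed

lemma sum_power_nonzero:
  fixes a :: "nat \<Rightarrow> real"
  assumes "k \<le> D" "a k \<noteq> 0" shows "\<exists>t. (\<Sum>k\<le>D. a k * t ^ k) \<noteq> 0"
proof (rule ccontr)
  assume "\<not> ?thesis"
  then have "\<forall>t. (\<Sum>k\<le>D. a k * t ^ k) = 0" by blast
  then show False using polyfun_eq_0[of a D] assms by auto
qed

text \<open>Group the sum by the exponent of the variable \<open>a\<close>: the coefficient of the
  power \<open>m0 a\<close> is a combination in the other variables, nonzero somewhere by induction,
  and then a univariate polynomial in the value of \<open>a\<close> remains.\<close>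

lemma monomial_fun_independent:
  assumes "finite I" "m0 \<in> I \<rightarrow>\<^sub>E {..D}" "c m0 \<noteq> 0"
  shows "\<exists>y. (\<Sum>m\<in>I \<rightarrow>\<^sub>E {..D}. c m * monomial_fun I m y) \<noteq> 0"
  using assms
proof (induction I arbitrary: m0 c rule: finite_induct)
  case empty
  then show ?case by (simp add: monomial_fun_def)
next
  case (insert a I)
  define k0 where "k0 = m0 a"
  define c' where "c' k m = c (m(a := k))" for k m
  have m0: "(m0(a := undefined)) \<in> I \<rightarrow>\<^sub>E {..D}" "k0 \<le> D"
    using insert by (auto simp: k0_def PiE_def extensional_def)
  have "c' k0 (m0(a := undefined)) \<noteq> 0" using insert by (simp add: c'_def k0_def)
  then obtain y where y: "(\<Sum>m\<in>I \<rightarrow>\<^sub>E {..D}. c' k0 m * monomial_fun I m y) \<noteq> 0"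
    using insert.IH[OF m0(1)] by blast
  obtain t where t: "(\<Sum>k\<le>D. (\<Sum>m\<in>I \<rightarrow>\<^sub>E {..D}. c' k m * monomial_fun I m y) * t ^ k) \<noteq> 0"
    using sum_power_nonzero[OF m0(2), of "\<lambda>k. \<Sum>m\<in>I \<rightarrow>\<^sub>E {..D}. c' k m * monomial_fun I m y"] y by blast
  have "(\<Sum>m\<in>insert a I \<rightarrow>\<^sub>E {..D}. c m * monomial_fun (insert a I) m (y(a := t)))
     = (\<Sum>(k, m)\<in>{..D} \<times> (I \<rightarrow>\<^sub>E {..D}). c (m(a := k)) * monomial_fun (insert a I) (m(a := k)) (y(a := t)))"
    unfolding PiE_insert_eq
    using inj_combinator[OF insert(2), of "\<lambda>_. {..D}"]
    by (subst sum.reindex) (auto simp: case_prod_unfold)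
  also have "\<dots> = (\<Sum>k\<le>D. \<Sum>m\<in>I \<rightarrow>\<^sub>E {..D}. c' k m * monomial_fun I m y * t ^ k)"
    unfolding sum.cartesian_product
  proof (intro sum.cong refl, safe)
    fix k m
    have "(\<Prod>i\<in>I. (y(a := t)) i ^ (m(a := k)) i) = (\<Prod>i\<in>I. y i ^ m i)"
      using insert by (intro prod.cong) auto
    then have "monomial_fun (insert a I) (m(a := k)) (y(a := t)) = t ^ k * monomial_fun I m y"
      unfolding monomial_fun_def using insert by simp
    then show "c (m(a := k)) * monomial_fun (insert a I) (m(a := k)) (y(a := t)) = c' k m * monomial_fun I m y * t ^ k"
      by (simp add: c'_def)
  qed
  finally have "(\<Sum>m\<in>insert a I \<rightarrow>\<^sub>E {..D}. c m * monomial_fun (insert a I) m (y(a := t)))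
      = (\<Sum>k\<le>D. \<Sum>m\<in>I \<rightarrow>\<^sub>E {..D}. c' k m * monomial_fun I m y * t ^ k)" .
  then have "(\<Sum>m\<in>insert a I \<rightarrow>\<^sub>E {..D}. c m * monomial_fun (insert a I) m (y(a := t))) \<noteq> 0"
    using t by (simp add: sum_distrib_right)
  then show ?case by blast
qed

text \<open>There are more monomials of bounded degree in the target variables than in the source
  variables, so some combination of them pulls back to zero.\<close>

lemma algebraic_dependence:
  fixes F :: "'i \<Rightarrow> ('j \<Rightarrow> real) \<Rightarrow> real"
  assumes fin: "finite I" "finite J" and card: "card J < card I"
    and F: "\<And>i. i \<in> I \<Longrightarrow> F i \<in> multipoly J"
  shows "\<exists>g\<in>multipoly I. (\<exists>z. g z \<noteq> 0) \<and> (\<forall>y. g (\<lambda>i. F i y) = 0)"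
proof -
  have "\<forall>i\<in>I. \<exists>D. F i \<in> poldeg J D" using multipoly_poldeg[OF fin(2) F] by blast
  then obtain deg where deg: "\<And>i. i \<in> I \<Longrightarrow> F i \<in> poldeg J (deg i)" by metis
  define e where "e = (\<Sum>i\<in>I. deg i)"
  have e: "F i \<in> poldeg J e" if "i \<in> I" for i
    using poldeg_mono[OF fin(2) _ deg[OF that]] member_le_sum[OF that _ fin(1), of deg]
    by (simp add: e_def)
  define N where "N = card I"
  \<comment> \<open>Unknowns are the target monomials \<open>U\<close>, equations the source
    monomials \<open>E\<close>. As N D e + 1 is at most (N e + 1)(D + 1), this choice bounds |E| by
    D (D + 1) ^ |J|, which is below (D + 1) ^ (|J| + 1) and hence below |U|.\<close>
  define D where "D = (N * e + 1) ^ card J"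
  define U where "U = I \<rightarrow>\<^sub>E {..D}"
  define E where "E = J \<rightarrow>\<^sub>E {..N * (D * e)}"
  have "card E = (N * (D * e) + 1) ^ card J"
    by (simp add: E_def card_PiE fin)
  also have "\<dots> \<le> ((N * e + 1) * (D + 1)) ^ card J"
    by (intro power_mono) (auto simp: algebra_simps)
  also have "\<dots> = D * (D + 1) ^ card J" unfolding D_def power_mult_distrib by simp
  also have "\<dots> < (D + 1) ^ Suc (card J)" by simp
  also have "\<dots> \<le> (D + 1) ^ card I" using card by (intro power_increasing) auto
  also have "\<dots> = card U" by (simp add: U_def card_PiE fin)
  finally have cEU: "card E < card U" .
  have finEU: "finite E" "finite U" by (auto simp: E_def U_def fin finite_PiE)
  have "(\<lambda>y. monomial_fun I m (\<lambda>i. F i y)) \<in> poldeg J (N * (D * e))" if "m \<in> U" for m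
  proof -
    have m: "m i \<le> D" if "i \<in> I" for i using \<open>m \<in> U\<close> that by (auto simp: U_def)
    have "(\<lambda>y. F i y ^ m i) \<in> poldeg J (D * e)" if "i \<in> I" for i
      using poldeg_power[OF fin(2) e[OF that], of "m i"] m[OF that] poldeg_mono[OF fin(2)]
      by (meson mult_le_mono1)
    from poldeg_prod[OF fin(2,1) this] show ?thesis by (simp add: monomial_fun_def N_def)
  qed
  then have "\<forall>m\<in>U. \<exists>c. \<forall>y. monomial_fun I m (\<lambda>i. F i y) = (\<Sum>m'\<in>E. c m' * monomial_fun J m' y)"
    unfolding poldeg_def E_def by blast
  from bchoice[OF this] obtain M' where
    "\<forall>m\<in>U. \<forall>y. monomial_fun I m (\<lambda>i. F i y) = (\<Sum>m'\<in>E. M' m m' * monomial_fun J m' y)" ..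
  moreover define M where "M m' m = M' m m'" for m' m
  ultimately have M: "monomial_fun I m (\<lambda>i. F i y) = (\<Sum>m'\<in>E. M m' m * monomial_fun J m' y)" if "m \<in> U" for m y
    using that by simp
  obtain c where c: "\<exists>u\<in>U. c u \<noteq> 0" "\<And>e. e \<in> E \<Longrightarrow> (\<Sum>u\<in>U. M e u * c u) = 0"
    using homogeneous_system[OF finEU cEU, of M] by blast
  define g where "g y = (\<Sum>m\<in>U. c m * monomial_fun I m y)" for y
  show ?thesis
  proof (intro bexI[of _ g] conjI allI)
    show "\<exists>z. g z \<noteq> 0"
      using c(1) monomial_fun_independent[OF fin(1)] unfolding g_def U_def by blast
    show "g \<in> multipoly I"
      unfolding g_def[abs_def] monomial_fun_def
      by (intro multipoly_sum multipoly_mult multipoly_const multipoly_prod multipoly_power multipoly_var)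
    fix y
    have "g (\<lambda>i. F i y) = (\<Sum>m\<in>U. \<Sum>m'\<in>E. (M m' m * c m) * monomial_fun J m' y)"
      unfolding g_def by (intro sum.cong refl) (simp add: M sum_distrib_left algebra_simps)
    also have "\<dots> = (\<Sum>m'\<in>E. \<Sum>m\<in>U. (M m' m * c m) * monomial_fun J m' y)" by (rule sum.swap)
    also have "\<dots> = 0" by (simp add: c(2) sum_distrib_right[symmetric])
    finally show "g (\<lambda>i. F i y) = 0" .
  qed
qed

section \<open>Generic properties of the data\<close>

lemma qA_entry_linear: "linear (\<lambda>P::'n::finite qdata. qA P i $ j $ k)"
  and qa_entry_linear: "linear (\<lambda>P::'n::finite qdata. qa P i $ j)"
  and qalpha_linear: "linear (\<lambda>P::'n::finite qdata. qalpha P i)"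
  by (auto simp: linear_iff qA_def qa_def qalpha_def)

lemma symmetric_data_entry:
  "symmetric_data P \<longleftrightarrow> (\<forall>i j k. qA P i $ j $ k = qA P i $ k $ j)"
  by (auto simp: symmetric_data_def vec_eq_iff transpose_def)

lemma symmetric_data_affine:
  assumes "symmetric_data P" "symmetric_data Q"
  shows "symmetric_data (P + t *\<^sub>R (Q - P))"
  using assms unfolding symmetric_data_entry by (simp add: qA_def)

section \<open>Closure properties of genericity\<close>

lemma generic_mono:
  assumes "generic_qdata Q" "\<And>P. symmetric_data P \<Longrightarrow> Q P \<Longrightarrow> R P"
  shows "generic_qdata R"
  using assms unfolding generic_qdata_def by blast

lemma generic_True: "generic_qdata (\<lambda>P::'n::finite qdata. True)"
proof -
  have "symmetric_data (0::'n qdata)" by (simp add: symmetric_data_entry qA_def)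
  then have "\<exists>P::'n qdata. symmetric_data P" by blast
  then show ?thesis unfolding generic_qdata_def
    by (intro bexI[OF _ pf_const[of 1]]) simp
qed

lemma generic_conj:
  assumes "generic_qdata Q" "generic_qdata R"
  shows "generic_qdata (\<lambda>P. Q P \<and> R P)"
proof -
  obtain g P where g: "g \<in> polyfun" "symmetric_data P" "g P \<noteq> 0"
    "\<And>P. symmetric_data P \<Longrightarrow> g P \<noteq> 0 \<Longrightarrow> Q P"
    using assms(1) unfolding generic_qdata_def by blast
  obtain h P' where h: "h \<in> polyfun" "symmetric_data P'" "h P' \<noteq> 0"
    "\<And>P. symmetric_data P \<Longrightarrow> h P \<noteq> 0 \<Longrightarrow> R P"
    using assms(2) unfolding generic_qdata_def by blast
  obtain t where "g (P + t *\<^sub>R (P' - P)) * h (P + t *\<^sub>R (P' - P)) \<noteq> 0"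
    using polyfun_mult_nonzero[OF g(1) h(1) g(3) h(3)] by blast
  then show ?thesis unfolding generic_qdata_def
    using symmetric_data_affine[OF g(2) h(2)] g(4) h(4)
    by (intro bexI[OF _ pf_mult[OF g(1) h(1)]]) (metis mult_eq_0_iff)
qed

lemma generic_ball:
  assumes "finite S" "\<And>s. s \<in> S \<Longrightarrow> generic_qdata (Q s)"
  shows "generic_qdata (\<lambda>P. \<forall>s\<in>S. Q s P)"
  using assms
proof (induction S rule: finite_induct)
  case empty
  then show ?case using generic_True by simp
next
  case (insert s S)
  then have "generic_qdata (\<lambda>P. Q s P \<and> (\<forall>s\<in>S. Q s P))"
    by (intro generic_conj) auto
  then show ?case by simp
qed

lemma generic_all:
  fixes Q :: "'b::finite \<Rightarrow> 'n::finite qdata \<Rightarrow> bool"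
  assumes "\<And>s. generic_qdata (Q s)"
  shows "generic_qdata (\<lambda>P. \<forall>s. Q s P)"
  using generic_ball[of UNIV Q] assms by simp

text \<open>Coordinates on symmetric data: the entries of a symmetric matrix are indexed by
  the sets \<open>{j, k}\<close>.\<close>

datatype 'n idx = IA 'n "'n set" | Ib 'n 'n | Ic 'n

definition sym_idx :: "'n::finite idx set" where
  "sym_idx = (\<Union>i j k. {IA i {j, k}}) \<union> (\<Union>i j. {Ib i j}) \<union> (\<Union>i. {Ic i})"

lemma sym_idx_simps [simp]: "IA i {j, k} \<in> sym_idx" "Ib i j \<in> sym_idx" "Ic i \<in> sym_idx"
  by (simp_all add: sym_idx_def) blast

lemma sym_idx_single [simp]: "IA i {j} \<in> sym_idx"
  using sym_idx_simps(1)[of i j j] by simp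

lemma finite_sym_idx: "finite (sym_idx :: 'n::finite idx set)"
  by (simp add: sym_idx_def)

text \<open>The representative of the unordered pair depends on \<open>s\<close> alone. Hence the
  entry is linear in \<open>M\<close> even off the symmetric matrices, and \<open>coords\<close>
  yields polynomials on the whole data space.\<close>

definition sym_entry :: "real^'n^'n \<Rightarrow> 'n set \<Rightarrow> real" where
  "sym_entry M s = (let p = SOME p. s = {fst p, snd p} in M $ fst p $ snd p)"

lemma sym_entry_eq:
  assumes "\<And>i j. M $ i $ j = M $ j $ i" shows "sym_entry M {i, j} = M $ i $ j"
proof -
  let ?p = "SOME p. {i, j} = {fst p, snd p}"
  have "{i, j} = {fst ?p, snd ?p}" by (rule someI[of _ "(i, j)"]) simp
  then have "i = fst ?p \<and> j = snd ?p \<or> i = snd ?p \<and> j = fst ?p"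
    by (simp only: doubleton_eq_iff)
  then show ?thesis using assms[of "fst ?p" "snd ?p"] unfolding sym_entry_def Let_def
    by (elim disjE conjE) simp_all
qed

text \<open>Decodes the second index of a slot {a, j}, with \<open>a\<close> itself for the
  singleton. It is used where the row \<open>a\<close> of slots of a matrix stores a vector.\<close>

definition pick :: "'n \<Rightarrow> 'n set \<Rightarrow> 'n" where "pick a s = (SOME j. s = {a, j})"

lemma pick_eq [simp]: "pick a {a, j} = j"
proof -
  have "{a, j} = {a, pick a {a, j}}" unfolding pick_def by (rule someI[of _ j]) simp
  then show ?thesis unfolding doubleton_eq_iff by metis
qed

lemma pick_single [simp]: "pick a {a} = a"
  using pick_eq[of a a] by simp

fun coords :: "'n::finite qdata \<Rightarrow> 'n idx \<Rightarrow> real" where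
  "coords P (IA i s) = sym_entry (qA P i) s"
| "coords P (Ib i j) = qa P i $ j"
| "coords P (Ic i) = qalpha P i"

definition of_coords :: "('n idx \<Rightarrow> real) \<Rightarrow> 'n::finite qdata" where
  "of_coords z = ((\<chi> i j k. z (IA i {j, k})), (\<chi> i j. z (Ib i j)), (\<chi> i. z (Ic i)))"

lemma symmetric_of_coords: "symmetric_data (of_coords z)"
  by (simp add: symmetric_data_entry of_coords_def qA_def insert_commute)

lemma coords_of_coords:
  assumes "i \<in> sym_idx" shows "coords (of_coords z) i = z i"
  using assms by (auto simp: sym_idx_def of_coords_def qA_def qa_def qalpha_def sym_entry_eq insert_commute)

lemma multipoly_cong:
  assumes "g \<in> multipoly I" "\<And>i. i \<in> I \<Longrightarrow> y i = z i" shows "g y = g z"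
  using assms(1) by induction (auto simp: assms(2))

lemma multipoly_coords_polyfun:
  assumes "g \<in> multipoly I" shows "(\<lambda>P. g (coords P)) \<in> polyfun"
  using assms
proof induction
  case (multipoly_var i)
  then show ?case
    by (cases i) (simp_all add: sym_entry_def Let_def polyfun_linear qA_entry_linear
        qa_entry_linear qalpha_linear)
qed (auto intro: polyfun.intros)

text \<open>The coordinates of \<open>G y\<close> are more numerous than the parameters, since the
  slot \<open>i0\<close> is not read; so they satisfy a nontrivial polynomial relation, and its
  nonvanishing excludes all bad data. \<open>G\<close> only has to cover the bad data, it may also
  hit good ones.\<close>

lemma generic_avoid:
  fixes G :: "('n::finite idx \<Rightarrow> real) \<Rightarrow> 'n qdata"
  assumes i0: "i0 \<in> sym_idx"
    and A: "\<And>i j k. (\<lambda>y. qA (G y) i $ j $ k) \<in> multipoly (sym_idx - {i0})"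
    and a: "\<And>i j. (\<lambda>y. qa (G y) i $ j) \<in> multipoly (sym_idx - {i0})"
    and al: "\<And>i. (\<lambda>y. qalpha (G y) i) \<in> multipoly (sym_idx - {i0})"
    and bad: "\<And>P. symmetric_data P \<Longrightarrow> \<not> Q P \<Longrightarrow> \<exists>y. P = G y"
  shows "generic_qdata Q"
proof -
  have F: "(\<lambda>y. coords (G y) i) \<in> multipoly (sym_idx - {i0})" for i
    by (cases i) (simp_all add: A a al sym_entry_def Let_def)
  have "card (sym_idx - {i0}) < card (sym_idx :: 'n idx set)"
    by (intro psubset_card_mono finite_sym_idx) (use i0 in blast)
  then obtain g z where g: "g \<in> multipoly sym_idx" "g z \<noteq> 0" "\<And>y. g (\<lambda>i. coords (G y) i) = 0"
    using algebraic_dependence[OF finite_sym_idx finite_Diff[OF finite_sym_idx], of "{i0}"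
        "\<lambda>i y. coords (G y) i"] F by blast
  \<comment> \<open>\<open>coords\<close> inverts \<open>of_coords\<close> only on
    \<open>sym_idx\<close>, but these are the only variables that \<open>g\<close> reads.\<close>
  have nz: "g (coords (of_coords z)) \<noteq> 0"
    using multipoly_cong[OF g(1), of "coords (of_coords z)" z] coords_of_coords g(2) by metis
  show ?thesis unfolding generic_qdata_def
  proof (intro bexI[of _ "\<lambda>P. g (coords P)"] conjI allI impI)
    show "\<exists>P. symmetric_data P \<and> g (coords P) \<noteq> 0" using nz symmetric_of_coords by blast
    fix P :: "'n qdata" assume P: "symmetric_data P \<and> g (coords P) \<noteq> 0"
    then show "Q P" using bad[of P] g(3) by auto
  qed (rule multipoly_coords_polyfun[OF g(1)])
qed

text \<open>The entries of the congruence \<open>C\<^sup>T N C\<close> where \<open>C\<close> has zero rows over \<open>Z\<close>; it is used with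
  the projections \<open>C\<close> along the kernel of a symmetric matrix.\<close>

definition congr_entry :: "'n set \<Rightarrow> ('n \<Rightarrow> 'n \<Rightarrow> real) \<Rightarrow> ('n \<Rightarrow> 'n \<Rightarrow> real) \<Rightarrow> 'n \<Rightarrow> 'n \<Rightarrow> real" where
  "congr_entry Z C N i j = (\<Sum>p\<in>-Z. \<Sum>q\<in>-Z. C p i * N p q * C q j)"

lemma congr_entry_cong:
  assumes "\<And>p i. p \<notin> Z \<Longrightarrow> C p i = C' p i" "\<And>p q. p \<notin> Z \<Longrightarrow> q \<notin> Z \<Longrightarrow> N p q = N' p q"
  shows "congr_entry Z C N i j = congr_entry Z C' N' i j"
  unfolding congr_entry_def using assms by (intro sum.cong refl) auto

text \<open>\<open>MC\<close> says M C = M; transposing gives \<open>C\<^sup>T M = M\<close> and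
  thus \<open>C\<^sup>T M C = M\<close>. The zero rows of \<open>C\<close> reduce the sums to
  indices off \<open>Z\<close>.\<close>

lemma congr_entry_eq:
  fixes M :: "real^'n::finite^'n"
  assumes sym: "\<And>i j. M $ i $ j = M $ j $ i"
    and MC: "\<And>p j. (\<Sum>q\<in>UNIV. M $ p $ q * C q j) = M $ p $ j"
    and Z: "\<And>p i. p \<in> Z \<Longrightarrow> C p i = 0"
  shows "congr_entry Z C (\<lambda>p q. M $ p $ q) i j = M $ i $ j"
proof -
  have "congr_entry Z C (\<lambda>p q. M $ p $ q) i j = (\<Sum>p\<in>UNIV. \<Sum>q\<in>UNIV. C p i * M $ p $ q * C q j)"
  proof -
    have "(\<Sum>q\<in>-Z. C p i * M $ p $ q * C q j) = (\<Sum>q\<in>UNIV. C p i * M $ p $ q * C q j)" for p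
      by (rule sum.mono_neutral_left) (simp_all add: Z)
    moreover have "(\<Sum>p\<in>-Z. \<Sum>q\<in>UNIV. C p i * M $ p $ q * C q j)
        = (\<Sum>p\<in>UNIV. \<Sum>q\<in>UNIV. C p i * M $ p $ q * C q j)"
      by (rule sum.mono_neutral_left) (simp_all add: Z)
    ultimately show ?thesis by (simp add: congr_entry_def)
  qed
  also have "\<dots> = (\<Sum>p\<in>UNIV. M $ j $ p * C p i)"
  proof (intro sum.cong refl)
    fix p
    have "(\<Sum>q\<in>UNIV. C p i * M $ p $ q * C q j) = C p i * (\<Sum>q\<in>UNIV. M $ p $ q * C q j)"
      by (simp add: sum_distrib_left mult.assoc)
    then show "(\<Sum>q\<in>UNIV. C p i * M $ p $ q * C q j) = M $ j $ p * C p i"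
      using MC[of p j] sym[of j p] by simp
  qed
  also have "\<dots> = M $ i $ j" using MC sym by metis
  finally show ?thesis .
qed

text \<open>The matrix \<open>I - e e\<^sub>l\<^sup>T\<close>: for an \<open>e\<close> with
  component 1 at \<open>l\<close>, the projection along \<open>e\<close> onto the vectors with zero
  component \<open>l\<close>.\<close>

definition proj1 :: "'n \<Rightarrow> ('n \<Rightarrow> real) \<Rightarrow> 'n \<Rightarrow> 'n \<Rightarrow> real" where
  "proj1 l e p i = (if p = i then 1 else 0) - (if i = l then e p else 0)"

text \<open>The matrix \<open>I - e e\<^sub>l\<^sup>T - w e\<^sub>k\<^sup>T\<close>, the projection
  along \<open>e\<close> and \<open>w\<close> when these are normalized to (1, 0) and (0, 1) in the
  components \<open>l\<close>, \<open>k\<close>.\<close>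

definition proj2 :: "'n \<Rightarrow> 'n \<Rightarrow> ('n \<Rightarrow> real) \<Rightarrow> ('n \<Rightarrow> real) \<Rightarrow> 'n \<Rightarrow> 'n \<Rightarrow> real" where
  "proj2 l k e w p i = (if p = i then 1 else 0) - (if i = l then e p else 0) - (if i = k then w p else 0)"

text \<open>A symmetric matrix killing \<open>e\<close> is recovered from \<open>e\<close> and its
  block off \<open>l\<close>, one parameter fewer than a full symmetric matrix. Since
  \<open>e'\<close> and \<open>N\<close> are unconstrained at \<open>l\<close>, the slots of row
  \<open>l\<close> can store something else.\<close>

lemma kernel_congr1:
  fixes M :: "real^'n::finite^'n"
  assumes sym: "\<And>i j. M $ i $ j = M $ j $ i" and e: "M *v e = 0" "e $ l = 1"
    and agree: "\<And>p. p \<noteq> l \<Longrightarrow> e' p = e $ p"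
      "\<And>p q. p \<noteq> l \<Longrightarrow> q \<noteq> l \<Longrightarrow> N p q = M $ p $ q"
  shows "M $ i $ j = congr_entry {l} (proj1 l e') N i j"
proof -
  have "congr_entry {l} (proj1 l e') N i j = congr_entry {l} (proj1 l (\<lambda>p. e $ p)) (\<lambda>p q. M $ p $ q) i j"
    using agree by (intro congr_entry_cong) (auto simp: proj1_def)
  also have "\<dots> = M $ i $ j"
  proof (intro congr_entry_eq sym)
    fix p j
    have "(\<Sum>q\<in>UNIV. M $ p $ q * proj1 l (\<lambda>p. e $ p) q j)
        = (\<Sum>q\<in>UNIV. if q = j then M $ p $ q else 0) - (\<Sum>q\<in>UNIV. if j = l then M $ p $ q * e $ q else 0)"
      unfolding sum_subtractf[symmetric] by (intro sum.cong) (auto simp: proj1_def algebra_simps)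
    also have "\<dots> = M $ p $ j - (if j = l then (M *v e) $ p else 0)"
      by (simp add: matrix_vector_mult_def)
    finally show "(\<Sum>q\<in>UNIV. M $ p $ q * proj1 l (\<lambda>p. e $ p) q j) = M $ p $ j" using e by simp
  qed (auto simp: proj1_def e)
  finally show ?thesis by simp
qed

text \<open>The same for a two-dimensional kernel with normalized basis, which saves three
  parameters.\<close>

lemma kernel_congr2:
  fixes M :: "real^'n::finite^'n"
  assumes sym: "\<And>i j. M $ i $ j = M $ j $ i"
    and e: "M *v e = 0" "e $ l = 1" "e $ k = 0" and w: "M *v w = 0" "w $ k = 1" "w $ l = 0"
    and agree: "\<And>p. p \<noteq> l \<Longrightarrow> p \<noteq> k \<Longrightarrow> e' p = e $ p" "\<And>p. p \<noteq> l \<Longrightarrow> p \<noteq> k \<Longrightarrow> w' p = w $ p"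
      "\<And>p q. p \<noteq> l \<Longrightarrow> p \<noteq> k \<Longrightarrow> q \<noteq> l \<Longrightarrow> q \<noteq> k \<Longrightarrow> N p q = M $ p $ q"
  shows "M $ i $ j = congr_entry {l, k} (proj2 l k e' w') N i j"
proof -
  have "congr_entry {l, k} (proj2 l k e' w') N i j
      = congr_entry {l, k} (proj2 l k (\<lambda>p. e $ p) (\<lambda>p. w $ p)) (\<lambda>p q. M $ p $ q) i j"
    using agree by (intro congr_entry_cong) (auto simp: proj2_def)
  also have "\<dots> = M $ i $ j"
  proof (intro congr_entry_eq sym)
    fix p j
    have "(\<Sum>q\<in>UNIV. M $ p $ q * proj2 l k (\<lambda>p. e $ p) (\<lambda>p. w $ p) q j)
        = (\<Sum>q\<in>UNIV. if q = j then M $ p $ q else 0) - (\<Sum>q\<in>UNIV. if j = l then M $ p $ q * e $ q else 0)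
          - (\<Sum>q\<in>UNIV. if j = k then M $ p $ q * w $ q else 0)"
      unfolding sum_subtractf[symmetric] by (intro sum.cong) (auto simp: proj2_def algebra_simps)
    also have "\<dots> = M $ p $ j - (if j = l then (M *v e) $ p else 0) - (if j = k then (M *v w) $ p else 0)"
      by (simp add: matrix_vector_mult_def)
    finally show "(\<Sum>q\<in>UNIV. M $ p $ q * proj2 l k (\<lambda>p. e $ p) (\<lambda>p. w $ p) q j) = M $ p $ j"
      using e w by simp
  qed (use e w in \<open>auto simp: proj2_def\<close>)
  finally show ?thesis by simp
qed

lemma multipoly_congr_entry:
  assumes "\<And>p i. p \<notin> Z \<Longrightarrow> (\<lambda>y. C y p i) \<in> multipoly J"
    and "\<And>p q. p \<notin> Z \<Longrightarrow> q \<notin> Z \<Longrightarrow> (\<lambda>y. N y p q) \<in> multipoly J"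
  shows "(\<lambda>y. congr_entry Z (C y) (N y) i j) \<in> multipoly J"
  unfolding congr_entry_def by (intro multipoly_sum multipoly_mult assms) auto

lemma multipoly_congr_proj1:
  assumes "\<And>p. p \<noteq> l \<Longrightarrow> (\<lambda>y. e y p) \<in> multipoly J"
    and "\<And>p q. p \<noteq> l \<Longrightarrow> q \<noteq> l \<Longrightarrow> (\<lambda>y. N y p q) \<in> multipoly J"
  shows "(\<lambda>y. congr_entry {l} (proj1 l (e y)) (N y) i j) \<in> multipoly J"
  unfolding proj1_def by (intro multipoly_congr_entry multipoly_diff multipoly_if multipoly_const assms) simp_all

lemma multipoly_congr_proj2:
  assumes "\<And>p. p \<noteq> l \<Longrightarrow> p \<noteq> k \<Longrightarrow> (\<lambda>y. e y p) \<in> multipoly J"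
    and "\<And>p. p \<noteq> l \<Longrightarrow> p \<noteq> k \<Longrightarrow> (\<lambda>y. w y p) \<in> multipoly J"
    and "\<And>p q. p \<noteq> l \<Longrightarrow> p \<noteq> k \<Longrightarrow> q \<noteq> l \<Longrightarrow> q \<noteq> k \<Longrightarrow> (\<lambda>y. N y p q) \<in> multipoly J"
  shows "(\<lambda>y. congr_entry {l, k} (proj2 l k (e y) (w y)) (N y) i j) \<in> multipoly J"
  unfolding proj2_def by (intro multipoly_congr_entry multipoly_diff multipoly_if multipoly_const assms) simp_all

section \<open>Data prescribed through a common zero\<close>

definition Amat :: "'n::finite qdata \<Rightarrow> real^'n \<Rightarrow> real^'n^'n" where
  "Amat P l = (\<Sum>i\<in>UNIV. l $ i *\<^sub>R qA P i)"

text \<open>Half the gradient of f_j at \<open>x\<close> when the data are symmetric; these are the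
  columns of half the Jacobian.\<close>

definition Bvec :: "'n::finite qdata \<Rightarrow> real^'n \<Rightarrow> 'n \<Rightarrow> real^'n" where
  "Bvec P x j = qA P j *v x + qa P j"

lemma Amat_entry: "Amat P l $ a $ b = (\<Sum>i\<in>UNIV. l $ i * qA P i $ a $ b)"
  by (simp add: Amat_def)

lemma Amat_mult: "Amat P l *v v = (\<Sum>i\<in>UNIV. l $ i *\<^sub>R (qA P i *v v))"
proof -
  have "(Amat P l *v v) $ a = (\<Sum>i\<in>UNIV. l $ i *\<^sub>R (qA P i *v v)) $ a" for a
  proof -
    have "(Amat P l *v v) $ a = (\<Sum>b\<in>UNIV. \<Sum>i\<in>UNIV. l $ i * qA P i $ a $ b * v $ b)"
      by (simp add: matrix_vector_mult_def Amat_entry sum_distrib_right)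
    also have "\<dots> = (\<Sum>i\<in>UNIV. \<Sum>b\<in>UNIV. l $ i * qA P i $ a $ b * v $ b)" by (rule sum.swap)
    also have "\<dots> = (\<Sum>i\<in>UNIV. l $ i *\<^sub>R (qA P i *v v)) $ a"
      by (simp add: matrix_vector_mult_def sum_distrib_left mult.assoc)
    finally show ?thesis .
  qed
  then show ?thesis by (simp add: vec_eq_iff)
qed

lemma symmetric_matD: "symmetric_data P \<Longrightarrow> qA P i $ a $ b = qA P i $ b $ a"
  by (simp add: symmetric_data_entry)

lemma Amat_sym: "symmetric_data P \<Longrightarrow> Amat P l $ a $ b = Amat P l $ b $ a"
  by (simp add: Amat_entry symmetric_matD[of P _ a b])

text \<open>A polynomial change of parameters: a_j is recovered from b_j = A_j x + a_j, and
  \<alpha>_j from f_j(x) = 0. Having as many equations as unknowns, one trades the n constants for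
  the n coordinates of \<open>x\<close>.\<close>

definition qdata_through :: "('n::finite \<Rightarrow> 'n \<Rightarrow> 'n \<Rightarrow> real) \<Rightarrow> ('n \<Rightarrow> 'n \<Rightarrow> real) \<Rightarrow> ('n \<Rightarrow> real) \<Rightarrow> 'n qdata" where
  "qdata_through A b x = ((\<chi> i j k. A i j k), (\<chi> j i. b j i - (\<Sum>q\<in>UNIV. A j i q * x q)),
     (\<chi> j. - ((\<Sum>p\<in>UNIV. \<Sum>q\<in>UNIV. x p * A j p q * x q)
          + 2 * (\<Sum>i\<in>UNIV. (b j i - (\<Sum>q\<in>UNIV. A j i q * x q)) * x i))))"

lemma qdata_through_eq:
  assumes "x \<in> Vf P"
  shows "P = qdata_through (\<lambda>i j k. qA P i $ j $ k) (\<lambda>j i. Bvec P x j $ i) (\<lambda>q. x $ q)"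
proof -
  have b: "Bvec P x j $ i - (\<Sum>q\<in>UNIV. qA P j $ i $ q * x $ q) = qa P j $ i" for i j
    by (simp add: Bvec_def matrix_vector_mult_def)
  have q: "qf P j x = 0" for j using assms by (simp add: Vf_def)
  have "qalpha P j = - ((\<Sum>p\<in>UNIV. \<Sum>q\<in>UNIV. x $ p * qA P j $ p $ q * x $ q)
          + 2 * (\<Sum>i\<in>UNIV. qa P j $ i * x $ i))" for j
    using q[of j]
    by (simp add: qf_def inner_vec_def matrix_vector_mult_def sum_distrib_left mult.assoc)
  then show ?thesis
    unfolding qdata_through_def b by (intro prod_eqI) (simp_all add: vec_eq_iff qA_def qa_def qalpha_def)
qed

lemma qdata_through_multipoly:
  assumes "\<And>i j k. (\<lambda>y. A y i j k) \<in> multipoly J" "\<And>i j. (\<lambda>y. b y i j) \<in> multipoly J" "\<And>i. (\<lambda>y. x y i) \<in> multipoly J"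
  shows "(\<lambda>y. qA (qdata_through (A y) (b y) (x y)) i $ j $ k) \<in> multipoly J"
    "(\<lambda>y. qa (qdata_through (A y) (b y) (x y)) i $ j) \<in> multipoly J"
    "(\<lambda>y. qalpha (qdata_through (A y) (b y) (x y)) i) \<in> multipoly J"
  unfolding qdata_through_def qA_def qa_def qalpha_def fst_conv snd_conv vec_lambda_beta
  by (intro assms multipoly_uminus multipoly_add multipoly_diff multipoly_sum multipoly_mult multipoly_const)+

text \<open>In a dependence with nonzero coefficient at \<open>k\<close>, the n entries of b_k are
  replaced by the n - 1 ratios expressing it through the other b_r. The ratios sit in the slots
  \<open>Ib k r\<close> with r different from \<open>k\<close>, and \<open>Ib k k\<close> stays
  free.\<close>

lemma generic_jacobian:
  "generic_qdata (\<lambda>P::'n::finite qdata. \<forall>x\<in>Vf P. \<forall>c::real^'n.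
      (\<Sum>j\<in>UNIV. c $ j *\<^sub>R Bvec P x j) = 0 \<longrightarrow> c = 0)"
proof -
  have "generic_qdata (\<lambda>P::'n qdata. \<forall>x\<in>Vf P. \<forall>c::real^'n.
      (\<Sum>j\<in>UNIV. c $ j *\<^sub>R Bvec P x j) = 0 \<longrightarrow> c $ k = 0)" for k
  proof -
    define A where "A y i a b = y (IA i {a, b})" for y :: "'n idx \<Rightarrow> real" and i a b
    define B where "B y j i = (if j = k then \<Sum>r\<in>UNIV - {k}. y (Ib k r) * y (Ib r i) else y (Ib j i))"
      for y :: "'n idx \<Rightarrow> real" and j i
    define X where "X y q = y (Ic q)" for y :: "'n idx \<Rightarrow> real" and q
    let ?J = "sym_idx - {Ib k k}"
    have multipoly: "(\<lambda>y. A y i a b) \<in> multipoly ?J" "(\<lambda>y. X y i) \<in> multipoly ?J" for i a b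
      unfolding A_def X_def by (simp_all add: multipoly_var)
    have poly_B: "(\<lambda>y. B y i j) \<in> multipoly ?J" for i j
      unfolding B_def by (intro multipoly_if multipoly_sum multipoly_mult multipoly_var; simp)
    show ?thesis
    proof (rule generic_avoid[of "Ib k k" "\<lambda>y. qdata_through (A y) (B y) (X y)"])
      fix P :: "'n qdata"
      assume P: "symmetric_data P" and "\<not> (\<forall>x\<in>Vf P. \<forall>c::real^'n.
        (\<Sum>j\<in>UNIV. c $ j *\<^sub>R Bvec P x j) = 0 \<longrightarrow> c $ k = 0)"
      then obtain x and c :: "real^'n" where x: "x \<in> Vf P"
        and c: "(\<Sum>j\<in>UNIV. c $ j *\<^sub>R Bvec P x j) = 0" "c $ k \<noteq> 0" by blast
      have Bk: "Bvec P x k $ i = (\<Sum>r\<in>UNIV - {k}. (- c $ r / c $ k) * Bvec P x r $ i)" for i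
      proof -
        have "0 = (\<Sum>j\<in>UNIV. c $ j *\<^sub>R Bvec P x j) $ i" using c by simp
        also have "\<dots> = c $ k * Bvec P x k $ i + (\<Sum>r\<in>UNIV - {k}. c $ r * Bvec P x r $ i)"
          by (simp add: sum.remove[of UNIV k])
        finally have "(\<Sum>r\<in>UNIV - {k}. c $ r * Bvec P x r $ i) = - c $ k * Bvec P x k $ i"
          by simp
        moreover have "(\<Sum>r\<in>UNIV - {k}. (- c $ r / c $ k) * Bvec P x r $ i)
          = (- 1 / c $ k) * (\<Sum>r\<in>UNIV - {k}. c $ r * Bvec P x r $ i)"
          unfolding sum_distrib_left by (intro sum.cong) auto
        ultimately show ?thesis using c by simp
      qed
      define y where "y i = (case i of IA r s \<Rightarrow> sym_entry (qA P r) s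
        | Ib j i \<Rightarrow> if j = k then - c $ i / c $ k else Bvec P x j $ i | Ic q \<Rightarrow> x $ q)" for i
      have "A y i a b = qA P i $ a $ b" for i a b
        by (simp add: A_def y_def sym_entry_eq symmetric_matD[OF P])
      then have "A y = (\<lambda>i a b. qA P i $ a $ b)" by blast
      moreover have "B y j i = Bvec P x j $ i" for i j
      proof (cases "j = k")
        case True
        have "B y j i = (\<Sum>r\<in>UNIV - {k}. (- c $ r / c $ k) * Bvec P x r $ i)"
          using True by (simp add: B_def y_def)
        then show ?thesis using Bk True by simp
      qed (simp add: B_def y_def)
      then have "B y = (\<lambda>j i. Bvec P x j $ i)" by blast
      moreover have "X y = (\<lambda>q. x $ q)" by (intro ext) (simp add: X_def y_def)
      ultimately have "P = qdata_through (A y) (B y) (X y)" using qdata_through_eq[OF x] by simp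
      then show "\<exists>y. P = qdata_through (A y) (B y) (X y)" by (rule exI[of _ y])
    qed (simp, (rule qdata_through_multipoly multipoly poly_B)+)
  qed
  then have "generic_qdata (\<lambda>P::'n qdata. \<forall>k. \<forall>x\<in>Vf P. \<forall>c::real^'n.
      (\<Sum>j\<in>UNIV. c $ j *\<^sub>R Bvec P x j) = 0 \<longrightarrow> c $ k = 0)"
    by (rule generic_all)
  then show ?thesis
  proof (rule generic_mono, intro ballI allI impI)
    fix P :: "'n qdata" and x and c :: "real^'n"
    assume "\<forall>k. \<forall>x\<in>Vf P. \<forall>c::real^'n. (\<Sum>j\<in>UNIV. c $ j *\<^sub>R Bvec P x j) = 0 \<longrightarrow> c $ k = 0"
      "x \<in> Vf P" "(\<Sum>j\<in>UNIV. c $ j *\<^sub>R Bvec P x j) = 0"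
    then have "c $ k = 0" for k by blast
    then show "c = 0" by (simp add: vec_eq_iff)
  qed
qed

text \<open>The left side is f_j(x') - f_j(x), by the exact second-order expansion at
  \<open>x\<close>.\<close>

lemma Vf_difference:
  assumes "symmetric_data P" "x \<in> Vf P" "x' \<in> Vf P"
  shows "(x' - x) \<bullet> (qA P j *v (x' - x)) + 2 * ((x' - x) \<bullet> Bvec P x j) = 0"
proof -
  let ?A = "qA P j"
  have t: "transpose ?A = ?A" using assms(1) by (simp add: symmetric_data_def)
  have s: "x' \<bullet> (?A *v x) = x \<bullet> (?A *v x')"
    by (metis dot_lmul_matrix transpose_matrix_vector t inner_commute)
  have "qf P j x' - qf P j x = 0" using assms by (simp add: Vf_def)
  then show ?thesis
    by (simp add: qf_def Bvec_def matrix_vector_mult_diff_distrib inner_simps s algebra_simps inner_commute[of "qa P j"])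
qed

text \<open>For two distinct points of \<open>Vf P\<close> the slots freed in the linear part by the \<open>n\<close> equations
  \<open>2 d \<bullet> b\<^sub>j = - d \<bullet> (A\<^sub>j d)\<close> hold the direction \<open>d\<close>, so only the matrices have to be
  parametrized.\<close>

lemma generic_pair:
  fixes Ae :: "('n::finite idx \<Rightarrow> real) \<Rightarrow> 'n \<Rightarrow> 'n \<Rightarrow> 'n \<Rightarrow> real"
  assumes i0: "IA m s \<in> sym_idx"
    and Ae: "\<And>i a b. (\<lambda>y. Ae y i a b) \<in> multipoly (sym_idx - {IA m s})"
    and bad: "\<And>P x x'. symmetric_data P \<Longrightarrow> (x' - x) $ l \<noteq> 0 \<Longrightarrow> \<not> R P (x' - x) \<Longrightarrow>
      \<exists>y1. \<forall>y. (\<forall>r s. y (IA r s) = y1 r s) \<longrightarrow>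
        (\<forall>p. p \<noteq> l \<longrightarrow> y (Ib p l) = (x' - x) $ p / (x' - x) $ l) \<longrightarrow>
        (\<forall>i a b. qA P i $ a $ b = Ae y i a b)"
  shows "generic_qdata (\<lambda>P. \<forall>x\<in>Vf P. \<forall>x'\<in>Vf P. (x' - x) $ l \<noteq> 0 \<longrightarrow> R P (x' - x))"
proof -
  \<comment> \<open>Here d = t \<open>ev\<close> with \<open>ev\<close> equal to 1 at
    \<open>l\<close>; the scale t is kept in \<open>Ib l l\<close> and the rest of the direction in
    \<open>Ib p l\<close>. Dividing the relation for d by 2t gives \<open>ev\<close> . b_j = - (t /
    2) \<open>ev\<close> . (A_j \<open>ev\<close>), which \<open>B\<close> solves for component
    \<open>l\<close> of b_j.\<close>
  define ev where "ev y p = (if p = l then 1 else y (Ib p l))" for y :: "'n idx \<Rightarrow> real" and p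
  define B where "B y j i = (if i = l then
      - (y (Ib l l) / 2) * (\<Sum>p\<in>UNIV. \<Sum>q\<in>UNIV. ev y p * Ae y j p q * ev y q)
        - (\<Sum>i\<in>UNIV - {l}. ev y i * y (Ib j i)) else y (Ib j i))" for y j i
  define X where "X y q = y (Ic q)" for y :: "'n idx \<Rightarrow> real" and q
  let ?J = "sym_idx - {IA m s}"
  have half: "- (t / 2) = (- 1 / 2) * t" for t :: real by simp
  have multipoly: "(\<lambda>y. B y i j) \<in> multipoly ?J" "(\<lambda>y. X y i) \<in> multipoly ?J" for i j
    unfolding B_def X_def ev_def half
    by (intro multipoly_if multipoly_sum multipoly_diff multipoly_mult multipoly_const multipoly_var Ae; simp)+
  show ?thesis
  proof (rule generic_avoid[OF i0, of "\<lambda>y. qdata_through (Ae y) (B y) (X y)"])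
    fix P :: "'n qdata"
    assume P: "symmetric_data P"
      and "\<not> (\<forall>x\<in>Vf P. \<forall>x'\<in>Vf P. (x' - x) $ l \<noteq> 0 \<longrightarrow> R P (x' - x))"
    then obtain x x' where x: "x \<in> Vf P" "x' \<in> Vf P" and nR: "\<not> R P (x' - x)"
      and l: "(x' - x) $ l \<noteq> 0" by blast
    obtain y1 where y1: "\<And>y. (\<forall>r s. y (IA r s) = y1 r s) \<Longrightarrow>
        (\<forall>p. p \<noteq> l \<longrightarrow> y (Ib p l) = (x' - x) $ p / (x' - x) $ l) \<Longrightarrow>
        (\<forall>i a b. qA P i $ a $ b = Ae y i a b)"
      using bad[OF P l nR] by blast
    define d where "d = x' - x"
    define t where "t = d $ l"
    have t: "t \<noteq> 0" using l by (simp add: t_def d_def)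
    define y where "y i = (case i of IA r s \<Rightarrow> y1 r s
        | Ib j i \<Rightarrow> if i = l then if j = l then t else d $ j / t else Bvec P x j $ i
        | Ic q \<Rightarrow> x $ q)" for i
    have Aeq: "Ae y = (\<lambda>i a b. qA P i $ a $ b)"
      using y1[of y] by (intro ext) (simp add: y_def t_def d_def)
    have ev: "d $ p = t * ev y p" for p using t by (simp add: ev_def y_def t_def)
    have "B y j l = Bvec P x j $ l" for j
    proof -
      have "0 = d \<bullet> (qA P j *v d) + 2 * (d \<bullet> Bvec P x j)"
        using Vf_difference[OF P x] by (simp add: d_def)
      also have "\<dots> = t * (t * (\<Sum>p\<in>UNIV. \<Sum>q\<in>UNIV. ev y p * qA P j $ p $ q * ev y q)
          + 2 * (\<Sum>p\<in>UNIV. ev y p * Bvec P x j $ p))"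
        by (simp add: inner_vec_def matrix_vector_mult_def ev sum_distrib_left algebra_simps)
      finally have "t * (\<Sum>p\<in>UNIV. \<Sum>q\<in>UNIV. ev y p * qA P j $ p $ q * ev y q)
          + 2 * (\<Sum>p\<in>UNIV. ev y p * Bvec P x j $ p) = 0" using t by simp
      moreover have "(\<Sum>p\<in>UNIV. ev y p * Bvec P x j $ p)
          = Bvec P x j $ l + (\<Sum>p\<in>UNIV - {l}. ev y p * y (Ib j p))"
        by (subst sum.remove[of UNIV l]) (auto simp: ev_def y_def intro!: sum.cong)
      moreover have "y (Ib l l) = t" by (simp add: y_def)
      ultimately show ?thesis by (simp add: B_def Aeq)
    qed
    moreover have "B y j i = Bvec P x j $ i" if "i \<noteq> l" for i j
      using that by (simp add: B_def y_def)
    ultimately have "B y = (\<lambda>j i. Bvec P x j $ i)" by (intro ext) metis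
    moreover have "X y = (\<lambda>q. x $ q)" by (intro ext) (simp add: X_def y_def)
    ultimately have "P = qdata_through (Ae y) (B y) (X y)" using qdata_through_eq[OF x(1)] Aeq by simp
    then show "\<exists>y. P = qdata_through (Ae y) (B y) (X y)" by (rule exI[of _ y])
  qed (rule qdata_through_multipoly Ae multipoly)+
qed

text \<open>For conditions on the matrices alone: linear parts and constants are copied, and the
  free slot must be gained within the matrices.\<close>

lemma generic_matrices:
  fixes Ae :: "('n::finite idx \<Rightarrow> real) \<Rightarrow> 'n \<Rightarrow> 'n \<Rightarrow> 'n \<Rightarrow> real"
  assumes i0: "IA m s \<in> sym_idx"
    and Ae: "\<And>i a b. (\<lambda>y. Ae y i a b) \<in> multipoly (sym_idx - {IA m s})"
    and bad: "\<And>P. symmetric_data P \<Longrightarrow> \<not> R P \<Longrightarrow>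
      \<exists>y1. \<forall>y. (\<forall>r s. y (IA r s) = y1 r s) \<longrightarrow> (\<forall>i a b. qA P i $ a $ b = Ae y i a b)"
  shows "generic_qdata R"
proof (rule generic_avoid[OF i0,
    of "\<lambda>y. ((\<chi> i a b. Ae y i a b), (\<chi> i j. y (Ib i j)), (\<chi> i. y (Ic i)))"])
  fix P :: "'n qdata" assume P: "symmetric_data P" "\<not> R P"
  then obtain y1 where y1: "\<And>y. (\<forall>r s. y (IA r s) = y1 r s) \<Longrightarrow> (\<forall>i a b. qA P i $ a $ b = Ae y i a b)"
    using bad by blast
  define y where "y i = (case i of IA r s \<Rightarrow> y1 r s
        | Ib j i \<Rightarrow> qa P j $ i | Ic q \<Rightarrow> qalpha P q)" for i
  have "qA P i $ a $ b = Ae y i a b" for i a b using y1[of y] by (simp add: y_def)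
  then have "P = ((\<chi> i a b. Ae y i a b), (\<chi> i j. y (Ib i j)), (\<chi> i. y (Ic i)))"
    by (intro prod_eqI) (simp_all add: vec_eq_iff qA_def qa_def qalpha_def y_def)
  then show "\<exists>y. P = ((\<chi> i a b. Ae y i a b), (\<chi> i j. y (Ib i j)), (\<chi> i. y (Ic i)))" by (rule exI[of _ y])
qed (auto simp: qA_def qa_def qalpha_def intro: Ae multipoly_var)

lemma Amat_solve:
  assumes "c $ k \<noteq> 0"
  shows "qA P k $ a $ b = Amat P c $ a $ b / c $ k - (\<Sum>r\<in>UNIV - {k}. (c $ r / c $ k) * qA P r $ a $ b)"
proof -
  have "Amat P c $ a $ b = c $ k * qA P k $ a $ b + (\<Sum>r\<in>UNIV - {k}. c $ r * qA P r $ a $ b)"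
    by (simp add: Amat_entry sum.remove[of UNIV k])
  moreover have "(\<Sum>r\<in>UNIV - {k}. (c $ r / c $ k) * qA P r $ a $ b)
      = (\<Sum>r\<in>UNIV - {k}. c $ r * qA P r $ a $ b) / c $ k"
    by (simp add: sum_divide_distrib)
  ultimately show ?thesis using assms by (simp add: field_simps)
qed

text \<open>If \<open>A(c) d = 0\<close> with \<open>c\<^sub>k \<noteq> 0\<close>, then \<open>A\<^sub>k\<close> is determined by the other matrices, the ratios
  \<open>c\<^sub>r / c\<^sub>k\<close> and the part of \<open>A(c) / c\<^sub>k\<close> off row \<open>l\<close>; the slots \<open>{l, r}\<close> of \<open>A\<^sub>k\<close> hold the ratios,
  and \<open>{l, k}\<close> remains free.\<close>

lemma generic_columns_index:
  "generic_qdata (\<lambda>P::'n::finite qdata. \<forall>x\<in>Vf P. \<forall>x'\<in>Vf P. (x' - x) $ l \<noteq> 0 \<longrightarrow>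
      (\<forall>c. Amat P c *v (x' - x) = 0 \<longrightarrow> c $ k = 0))"
proof (rule generic_pair[of k "{l, k}" "\<lambda>y i a b.
    if i = k then congr_entry {l} (proj1 l (\<lambda>p. y (Ib p l))) (\<lambda>p q. y (IA k {p, q})) a b
      - (\<Sum>r\<in>UNIV - {k}. y (IA k {l, r}) * y (IA r {a, b}))
    else y (IA i {a, b})" l "\<lambda>P d. \<forall>c. Amat P c *v d = 0 \<longrightarrow> c $ k = 0"], goal_cases)
  case (2 i a b)
  show ?case
    by (intro multipoly_if multipoly_diff multipoly_sum multipoly_mult multipoly_congr_proj1 multipoly_var)
      (auto simp: doubleton_eq_iff)
next
  case (3 P x x')
  define d where "d = x' - x"
  obtain c where c: "Amat P c *v d = 0" "c $ k \<noteq> 0" using 3 by (auto simp: d_def)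
  \<comment> \<open>Scaling the coefficient of A_k to 1 leaves only n - 1 ratios to be
    stored.\<close>
  define M where "M = (1 / c $ k) *\<^sub>R Amat P c"
  define e where "e = (1 / d $ l) *\<^sub>R d"
  have M: "M $ a $ b = M $ b $ a" for a b using Amat_sym[OF 3(1)] by (simp add: M_def)
  have e: "M *v e = 0" "e $ l = 1"
    using c 3(2) by (simp_all add: M_def e_def d_def matrix_vector_mult_scaleR flip: scaleR_matrix_vector_assoc)
  define y1 where "y1 r s = (if r = k then if l \<in> s then c $ pick l s / c $ k else sym_entry M s
      else sym_entry (qA P r) s)" for r s
  show ?case
  proof (intro exI[of _ y1] allI impI, unfold d_def[symmetric])
    fix y :: "'n idx \<Rightarrow> real" and i a b
    assume y: "\<forall>r s. y (IA r s) = y1 r s" "\<forall>p. p \<noteq> l \<longrightarrow> y (Ib p l) = d $ p / d $ l"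
    have A: "y (IA r {a, b}) = qA P r $ a $ b" if "r \<noteq> k" for r a b
      using that y by (simp add: y1_def sym_entry_eq symmetric_matD[OF 3(1)])
    have "M $ a $ b = congr_entry {l} (proj1 l (\<lambda>p. y (Ib p l))) (\<lambda>p q. y (IA k {p, q})) a b"
      by (rule kernel_congr1[OF M e]) (use y in \<open>auto simp: e_def y1_def sym_entry_eq[OF M]\<close>)
    moreover have "(\<Sum>r\<in>UNIV - {k}. y (IA k {l, r}) * y (IA r {a, b}))
        = (\<Sum>r\<in>UNIV - {k}. (c $ r / c $ k) * qA P r $ a $ b)"
      by (rule sum.cong) (use y A in \<open>auto simp: y1_def\<close>)
    ultimately show "qA P i $ a $ b =
       (if i = k then congr_entry {l} (proj1 l (\<lambda>p. y (Ib p l))) (\<lambda>p q. y (IA k {p, q})) a b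
          - (\<Sum>r\<in>UNIV - {k}. y (IA k {l, r}) * y (IA r {a, b}))
        else y (IA i {a, b}))"
      using Amat_solve[OF c(2), of P a b] A by (simp add: M_def)
  qed
qed simp

text \<open>Here \<open>I - A(c)\<close> has the kernel vectors \<open>d\<close> and \<open>w\<close>. The slots \<open>{l, r}\<close> of \<open>A\<^sub>m\<close> hold \<open>1 / c\<^sub>m\<close> and
  the ratios \<open>c\<^sub>r / c\<^sub>m\<close>, the slots \<open>{k, p}\<close> hold \<open>w\<close>, and \<open>{k}\<close> remains free.\<close>

lemma generic_corank_index:
  assumes "k \<noteq> l"
  shows "generic_qdata (\<lambda>P::'n::finite qdata. \<forall>x\<in>Vf P. \<forall>x'\<in>Vf P. (x' - x) $ l \<noteq> 0 \<longrightarrow>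
      (\<forall>c w. c $ m \<noteq> 0 \<longrightarrow> Amat P c *v (x' - x) = x' - x \<longrightarrow> Amat P c *v w = w \<longrightarrow>
        w $ l = 0 \<longrightarrow> w $ k = 0))"
proof (rule generic_pair[of m "{k}" "\<lambda>y i a b.
    if i = m then y (IA m {l, m}) * ((if a = b then 1 else 0) -
        congr_entry {l, k} (proj2 l k (\<lambda>p. y (Ib p l) - y (Ib k l) * y (IA m {k, p})) (\<lambda>p. y (IA m {k, p})))
          (\<lambda>p q. y (IA m {p, q})) a b)
      - (\<Sum>r\<in>UNIV - {m}. y (IA m {l, r}) * y (IA r {a, b}))
    else y (IA i {a, b})" l "\<lambda>P d. \<forall>c w. c $ m \<noteq> 0 \<longrightarrow> Amat P c *v d = d \<longrightarrow>
      Amat P c *v w = w \<longrightarrow> w $ l = 0 \<longrightarrow> w $ k = 0"], goal_cases)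
  case (2 i a b)
  show ?case
    by (intro multipoly_if multipoly_diff multipoly_sum multipoly_mult multipoly_congr_proj2 multipoly_var multipoly_const)
      (use assms in auto)
next
  case (3 P x x')
  define d where "d = x' - x"
  obtain c w0 where c: "Amat P c *v d = d" "c $ m \<noteq> 0"
    and w0: "Amat P c *v w0 = w0" "w0 $ l = 0" "w0 $ k \<noteq> 0" using 3 by (auto simp: d_def)
  define M where "M = mat 1 - Amat P c"
  define w where "w = (1 / w0 $ k) *\<^sub>R w0"
  \<comment> \<open>The multiple of \<open>w\<close> clears component \<open>k\<close> as
    \<open>proj2\<close> demands. The family rebuilds this vector from d / d_l in the slots
    \<open>Ib p l\<close> and \<open>w\<close> in the slots {k, p} of A_m.\<close>
  define e where "e = (1 / d $ l) *\<^sub>R d - (d $ k / d $ l) *\<^sub>R w"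
  have M: "M $ a $ b = M $ b $ a" for a b using Amat_sym[OF 3(1)] by (simp add: M_def mat_def)
  have w: "M *v w = 0" "w $ k = 1" "w $ l = 0"
    using w0 by (simp_all add: M_def w_def matrix_vector_mult_scaleR matrix_vector_mult_diff_rdistrib)
  have "M *v d = 0" using c by (simp add: M_def matrix_vector_mult_diff_rdistrib)
  then have e: "M *v e = 0" "e $ l = 1" "e $ k = 0"
    using 3(2) w by (simp_all add: e_def d_def matrix_vector_mult_scaleR matrix_vector_mult_diff_distrib)
  \<comment> \<open>The equation A(c) d = d is not homogeneous in c, so besides the ratios the scale
    1 / c_m is needed; it goes to {l, m}, where the ratio would be the constant 1.\<close>
  define y1 where "y1 r s = (if r = m then
        if l \<in> s then (if pick l s = m then 1 / c $ m else c $ pick l s / c $ m)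
        else if k \<in> s then w $ pick k s else sym_entry M s
      else sym_entry (qA P r) s)" for r s
  show ?case
  proof (intro exI[of _ y1] allI impI, unfold d_def[symmetric])
    fix y :: "'n idx \<Rightarrow> real" and i a b
    assume y: "\<forall>r s. y (IA r s) = y1 r s" "\<forall>p. p \<noteq> l \<longrightarrow> y (Ib p l) = d $ p / d $ l"
    have A: "y (IA r {a, b}) = qA P r $ a $ b" if "r \<noteq> m" for r a b
      using that y by (simp add: y1_def sym_entry_eq symmetric_matD[OF 3(1)])
    have "M $ a $ b = congr_entry {l, k} (proj2 l k (\<lambda>p. y (Ib p l) - y (Ib k l) * y (IA m {k, p})) (\<lambda>p. y (IA m {k, p})))
          (\<lambda>p q. y (IA m {p, q})) a b"
      by (rule kernel_congr2[OF M e w])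
        (use y assms in \<open>auto simp: e_def y1_def sym_entry_eq[OF M]\<close>)
    moreover have "(\<Sum>r\<in>UNIV - {m}. y (IA m {l, r}) * y (IA r {a, b}))
        = (\<Sum>r\<in>UNIV - {m}. (c $ r / c $ m) * qA P r $ a $ b)"
      by (rule sum.cong) (use y A in \<open>auto simp: y1_def\<close>)
    moreover have "y (IA m {l, m}) = 1 / c $ m" using y by (simp add: y1_def)
    moreover have "Amat P c $ a $ b = (if a = b then 1 else 0) - M $ a $ b" by (simp add: M_def mat_def)
    ultimately show "qA P i $ a $ b =
       (if i = m then y (IA m {l, m}) * ((if a = b then 1 else 0) -
        congr_entry {l, k} (proj2 l k (\<lambda>p. y (Ib p l) - y (Ib k l) * y (IA m {k, p})) (\<lambda>p. y (IA m {k, p})))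
          (\<lambda>p q. y (IA m {p, q})) a b)
      - (\<Sum>r\<in>UNIV - {m}. y (IA m {l, r}) * y (IA r {a, b}))
    else y (IA i {a, b}))"
      using Amat_solve[OF c(2), of P a b] A by simp
  qed
qed simp

text \<open>No zeros of f are involved, so the direction of \<open>v\<close> must be stored in the
  matrices: A_m - t I kills \<open>v\<close>, which frees row \<open>l\<close> of A_m for t (slot
  {l}) and for v / v_l (slots {l, p}). Then A_k is eliminated as in
  \<open>generic_columns_index\<close>, with {l, k} of A_k free; \<open>k\<close> differs from
  \<open>m\<close> because both row-\<open>l\<close> stores are in use.\<close>

lemma generic_eigen_columns_index:
  assumes "k \<noteq> m"
  shows "generic_qdata (\<lambda>P::'n::finite qdata. \<forall>v t c. v $ l \<noteq> 0 \<longrightarrow> qA P m *v v = t *\<^sub>R v \<longrightarrow>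
      Amat P c *v v = 0 \<longrightarrow> c $ k = 0)"
proof -
  define Am where "Am y a b = y (IA m {l}) * (if a = b then 1 else 0) +
      congr_entry {l} (proj1 l (\<lambda>p. y (IA m {l, p}))) (\<lambda>p q. y (IA m {p, q})) a b" for y :: "'n idx \<Rightarrow> real" and a b
  have Am: "(\<lambda>y. Am y a b) \<in> multipoly (sym_idx - {IA k {l, k}})" for a b
    unfolding Am_def
    by (intro multipoly_add multipoly_mult multipoly_congr_proj1 multipoly_var multipoly_const) (use assms in auto)
  show ?thesis
  proof (rule generic_matrices[of k "{l, k}" "\<lambda>y i a b.
      if i = k then congr_entry {l} (proj1 l (\<lambda>p. y (IA m {l, p}))) (\<lambda>p q. y (IA k {p, q})) a b
        - (\<Sum>r\<in>UNIV - {k}. y (IA k {l, r}) * (if r = m then Am y a b else y (IA r {a, b})))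
      else if i = m then Am y a b else y (IA i {a, b})"], goal_cases)
    case (2 i a b)
    show ?case
      by (intro multipoly_if multipoly_diff multipoly_sum multipoly_mult multipoly_congr_proj1 multipoly_var Am)
        (use assms in \<open>auto simp: doubleton_eq_iff\<close>)
  next
    case (3 P)
    then obtain v t c where v: "v $ l \<noteq> 0" "qA P m *v v = t *\<^sub>R v"
      and c: "Amat P c *v v = 0" "c $ k \<noteq> 0" by auto
    define M where "M = (1 / c $ k) *\<^sub>R Amat P c"
    define N where "N = qA P m - t *\<^sub>R mat 1"
    define e where "e = (1 / v $ l) *\<^sub>R v"
    have M: "M $ a $ b = M $ b $ a" for a b using Amat_sym[OF 3(1)] by (simp add: M_def)
    have N: "N $ a $ b = N $ b $ a" for a b using symmetric_matD[OF 3(1)] by (simp add: N_def mat_def)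
    have e: "M *v e = 0" "N *v e = 0" "e $ l = 1"
      using c v by (simp_all add: M_def N_def e_def matrix_vector_mult_scaleR
          matrix_vector_mult_diff_rdistrib flip: scaleR_matrix_vector_assoc)
    define y1 where "y1 r s = (if r = k then if l \<in> s then c $ pick l s / c $ k else sym_entry M s
        else if r = m then if l \<in> s then (if pick l s = l then t else e $ pick l s) else sym_entry N s
        else sym_entry (qA P r) s)" for r s
    show ?case
    proof (intro exI[of _ y1] allI impI)
      fix y :: "'n idx \<Rightarrow> real" and i a b
      assume y: "\<forall>r s. y (IA r s) = y1 r s"
      have A: "y (IA r {a, b}) = qA P r $ a $ b" if "r \<noteq> k" "r \<noteq> m" for r a b
        using that y by (simp add: y1_def sym_entry_eq symmetric_matD[OF 3(1)])
      have Mab: "M $ a $ b = congr_entry {l} (proj1 l (\<lambda>p. y (IA m {l, p}))) (\<lambda>p q. y (IA k {p, q})) a b"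
        by (rule kernel_congr1[OF M e(1,3)]) (use y assms in \<open>auto simp: y1_def sym_entry_eq[OF M]\<close>)
      have "N $ a $ b = congr_entry {l} (proj1 l (\<lambda>p. y (IA m {l, p}))) (\<lambda>p q. y (IA m {p, q})) a b"
        by (rule kernel_congr1[OF N e(2,3)]) (use y assms in \<open>auto simp: y1_def sym_entry_eq[OF N]\<close>)
      moreover have "y (IA m {l}) = t" using y assms by (simp add: y1_def)
      ultimately have Am: "Am y a b = qA P m $ a $ b" by (simp add: Am_def N_def mat_def)
      have "(\<Sum>r\<in>UNIV - {k}. y (IA k {l, r}) * (if r = m then Am y a b else y (IA r {a, b})))
          = (\<Sum>r\<in>UNIV - {k}. (c $ r / c $ k) * qA P r $ a $ b)"
        by (rule sum.cong) (use y A Am in \<open>auto simp: y1_def\<close>)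
      then show "qA P i $ a $ b = (if i = k then
          congr_entry {l} (proj1 l (\<lambda>p. y (IA m {l, p}))) (\<lambda>p q. y (IA k {p, q})) a b
          - (\<Sum>r\<in>UNIV - {k}. y (IA k {l, r}) * (if r = m then Am y a b else y (IA r {a, b})))
        else if i = m then Am y a b else y (IA i {a, b}))"
        using Amat_solve[OF c(2), of P a b] A Am Mab by (simp add: M_def)
    qed
  qed simp
qed

text \<open>A_m - t I would have two independent kernel vectors, which saves three parameters and
  costs one for t. Slot {l} holds t, {l, p} and {k, p} hold the kernel basis, {k} remains.\<close>

lemma generic_simple_eigenvalue_index:
  assumes "k \<noteq> l"
  shows "generic_qdata (\<lambda>P::'n::finite qdata. \<forall>v w t. v $ l \<noteq> 0 \<longrightarrow> qA P m *v v = t *\<^sub>R v \<longrightarrow>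
      qA P m *v w = t *\<^sub>R w \<longrightarrow> w $ l = 0 \<longrightarrow> w $ k = 0)"
proof (rule generic_matrices[of m "{k}" "\<lambda>y i a b.
    if i = m then y (IA m {l}) * (if a = b then 1 else 0) +
        congr_entry {l, k} (proj2 l k (\<lambda>p. y (IA m {l, p})) (\<lambda>p. y (IA m {k, p}))) (\<lambda>p q. y (IA m {p, q})) a b
    else y (IA i {a, b})"], goal_cases)
  case (2 i a b)
  show ?case
    by (intro multipoly_if multipoly_add multipoly_mult multipoly_congr_proj2 multipoly_var multipoly_const) (use assms in auto)
next
  case (3 P)
  then obtain v w0 t where v: "v $ l \<noteq> 0" "qA P m *v v = t *\<^sub>R v"
    and w0: "qA P m *v w0 = t *\<^sub>R w0" "w0 $ l = 0" "w0 $ k \<noteq> 0" by auto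
  define N where "N = qA P m - t *\<^sub>R mat 1"
  define w where "w = (1 / w0 $ k) *\<^sub>R w0"
  define e where "e = (1 / v $ l) *\<^sub>R v - (v $ k / v $ l) *\<^sub>R w"
  have N: "N $ a $ b = N $ b $ a" for a b using symmetric_matD[OF 3(1)] by (simp add: N_def mat_def)
  have w: "N *v w = 0" "w $ k = 1" "w $ l = 0"
    using w0 by (simp_all add: N_def w_def matrix_vector_mult_scaleR
        matrix_vector_mult_diff_rdistrib flip: scaleR_matrix_vector_assoc)
  have "N *v v = 0"
    using v by (simp add: N_def matrix_vector_mult_diff_rdistrib flip: scaleR_matrix_vector_assoc)
  then have e: "N *v e = 0" "e $ l = 1" "e $ k = 0"
    using v w by (simp_all add: e_def matrix_vector_mult_scaleR matrix_vector_mult_diff_distrib)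
  define y1 where "y1 r s = (if r = m then
        if l \<in> s then (if pick l s = l then t else e $ pick l s)
        else if k \<in> s then w $ pick k s else sym_entry N s
      else sym_entry (qA P r) s)" for r s
  show ?case
  proof (intro exI[of _ y1] allI impI)
    fix y :: "'n idx \<Rightarrow> real" and i a b
    assume y: "\<forall>r s. y (IA r s) = y1 r s"
    have A: "y (IA r {a, b}) = qA P r $ a $ b" if "r \<noteq> m" for r a b
      using that y by (simp add: y1_def sym_entry_eq symmetric_matD[OF 3(1)])
    have "N $ a $ b = congr_entry {l, k} (proj2 l k (\<lambda>p. y (IA m {l, p})) (\<lambda>p. y (IA m {k, p})))
          (\<lambda>p q. y (IA m {p, q})) a b"
      by (rule kernel_congr2[OF N e w]) (use y assms in \<open>auto simp: y1_def sym_entry_eq[OF N]\<close>)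
    moreover have "y (IA m {l}) = t" using y by (simp add: y1_def)
    ultimately show "qA P i $ a $ b = (if i = m then y (IA m {l}) * (if a = b then 1 else 0) +
        congr_entry {l, k} (proj2 l k (\<lambda>p. y (IA m {l, p})) (\<lambda>p. y (IA m {k, p}))) (\<lambda>p q. y (IA m {p, q})) a b
      else y (IA i {a, b}))"
      using A by (simp add: N_def mat_def)
  qed
qed simp

section \<open>The generic conditions in vector form\<close>

lemma generic_all2:
  fixes Q :: "'b::finite \<Rightarrow> 'c::finite \<Rightarrow> 'n::finite qdata \<Rightarrow> bool"
  assumes "\<And>k l. generic_qdata (Q k l)"
  shows "generic_qdata (\<lambda>P. \<forall>k l. Q k l P)"
  by (rule generic_all, rule generic_all, rule assms)

lemma generic_imp:
  assumes "c \<Longrightarrow> generic_qdata Q" shows "generic_qdata (\<lambda>P. c \<longrightarrow> Q P)"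
  using assms generic_True by (cases c) auto

lemma vec_nonzero_component:
  fixes v :: "real^'n" assumes "v \<noteq> 0" obtains l where "v $ l \<noteq> 0"
  using assms by (auto simp: vec_eq_iff)

lemma generic_columns:
  "generic_qdata (\<lambda>P::'n::finite qdata. \<forall>x\<in>Vf P. \<forall>x'\<in>Vf P. x \<noteq> x' \<longrightarrow>
      (\<forall>c. Amat P c *v (x' - x) = 0 \<longrightarrow> c = 0))"
proof (rule generic_mono[OF generic_all2[OF generic_columns_index]], intro ballI impI allI)
  fix P :: "'n qdata" and x x' c
  assume *: "\<forall>l k. \<forall>x\<in>Vf P. \<forall>x'\<in>Vf P. (x' - x) $ l \<noteq> 0 \<longrightarrow> (\<forall>c. Amat P c *v (x' - x) = 0 \<longrightarrow> c $ k = 0)"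
    and x: "x \<in> Vf P" "x' \<in> Vf P" and ne: "x \<noteq> x'" and c: "Amat P c *v (x' - x) = 0"
  have "x' - x \<noteq> 0" using ne by simp
  then obtain l where l: "(x' - x) $ l \<noteq> 0" by (rule vec_nonzero_component)
  have "c $ k = 0" for k using *[rule_format, OF x l c] .
  then show "c = 0" by (simp add: vec_eq_iff)
qed

lemma generic_corank:
  "generic_qdata (\<lambda>P::'n::finite qdata. \<forall>x\<in>Vf P. \<forall>x'\<in>Vf P. x \<noteq> x' \<longrightarrow>
      (\<forall>c w. Amat P c *v (x' - x) = x' - x \<longrightarrow> Amat P c *v w = w \<longrightarrow> (\<exists>s. w = s *\<^sub>R (x' - x))))"
proof -
  have "generic_qdata (\<lambda>P::'n qdata. \<forall>m k l. k \<noteq> l \<longrightarrow> (\<forall>x\<in>Vf P. \<forall>x'\<in>Vf P. (x' - x) $ l \<noteq> 0 \<longrightarrow>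
      (\<forall>c w. c $ m \<noteq> 0 \<longrightarrow> Amat P c *v (x' - x) = x' - x \<longrightarrow> Amat P c *v w = w \<longrightarrow>
        w $ l = 0 \<longrightarrow> w $ k = 0)))"
    by (rule generic_all, rule generic_all2, rule generic_imp, rule generic_corank_index)
  then show ?thesis
  proof (rule generic_mono, intro ballI impI allI)
    fix P :: "'n qdata" and x x' c w
    assume *: "\<forall>m k l. k \<noteq> l \<longrightarrow> (\<forall>x\<in>Vf P. \<forall>x'\<in>Vf P. (x' - x) $ l \<noteq> 0 \<longrightarrow>
      (\<forall>c w. c $ m \<noteq> 0 \<longrightarrow> Amat P c *v (x' - x) = x' - x \<longrightarrow> Amat P c *v w = w \<longrightarrow>
        w $ l = 0 \<longrightarrow> w $ k = 0))"
      and x: "x \<in> Vf P" "x' \<in> Vf P" and ne: "x \<noteq> x'" and c: "Amat P c *v (x' - x) = x' - x"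
      and w: "Amat P c *v w = w"
    have "x' - x \<noteq> 0" using ne by simp
    then obtain l where l: "(x' - x) $ l \<noteq> 0" by (rule vec_nonzero_component)
    have "c \<noteq> 0" using c ne by (auto simp: Amat_mult)
    then obtain m where m: "c $ m \<noteq> 0" by (rule vec_nonzero_component)
    \<comment> \<open>Chosen so that w' = w - s d has zero component \<open>l\<close>; the
      componentwise condition then annihilates all of w'.\<close>
    define s where "s = w $ l / (x' - x) $ l"
    define w' where "w' = w - s *\<^sub>R (x' - x)"
    have w': "Amat P c *v w' = w'" "w' $ l = 0"
      using w c l by (simp_all add: w'_def s_def matrix_vector_mult_diff_distrib[of _ w] matrix_vector_mult_scaleR)
    have "w' $ k = 0" for k
      using *[rule_format, OF _ x l m c w'] w'(2) by metis
    then have "w' = 0" by (simp add: vec_eq_iff)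
    then show "\<exists>s. w = s *\<^sub>R (x' - x)" unfolding w'_def by auto
  qed
qed

text \<open>The indexed version kills every c_k except c_m; what is left is c_m t v = 0, where a
  nonzero eigenvalue is essential.\<close>

lemma generic_eigen_columns:
  "generic_qdata (\<lambda>P::'n::finite qdata. \<forall>v t c. v \<noteq> 0 \<longrightarrow> t \<noteq> 0 \<longrightarrow> qA P m *v v = t *\<^sub>R v \<longrightarrow>
      Amat P c *v v = 0 \<longrightarrow> c = 0)"
proof -
  have "generic_qdata (\<lambda>P::'n qdata. \<forall>k l. k \<noteq> m \<longrightarrow> (\<forall>v t c. v $ l \<noteq> 0 \<longrightarrow> qA P m *v v = t *\<^sub>R v \<longrightarrow>
      Amat P c *v v = 0 \<longrightarrow> c $ k = 0))"
    by (rule generic_all2, rule generic_imp, rule generic_eigen_columns_index)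
  then show ?thesis
  proof (rule generic_mono, intro impI allI)
    fix P :: "'n qdata" and v t c
    assume *: "\<forall>k l. k \<noteq> m \<longrightarrow> (\<forall>v t c. v $ l \<noteq> 0 \<longrightarrow> qA P m *v v = t *\<^sub>R v \<longrightarrow>
      Amat P c *v v = 0 \<longrightarrow> c $ k = 0)"
      and v: "v \<noteq> 0" "t \<noteq> 0" "qA P m *v v = t *\<^sub>R v" and c: "Amat P c *v v = 0"
    obtain l where l: "v $ l \<noteq> 0" using vec_nonzero_component[OF v(1)] .
    have k: "c $ k = 0" if "k \<noteq> m" for k using *[rule_format, OF that l v(3) c] .
    then have "Amat P c *v v = c $ m *\<^sub>R (qA P m *v v)"
      by (simp add: Amat_mult sum.remove[of UNIV m])
    then have "c $ m = 0" using c v by simp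
    then show "c = 0" using k by (metis vec_eq_iff zero_index)
  qed
qed

lemma generic_simple_eigenvalue:
  "generic_qdata (\<lambda>P::'n::finite qdata. \<forall>v w t. v \<noteq> 0 \<longrightarrow> qA P m *v v = t *\<^sub>R v \<longrightarrow>
      qA P m *v w = t *\<^sub>R w \<longrightarrow> (\<exists>s. w = s *\<^sub>R v))"
proof -
  have "generic_qdata (\<lambda>P::'n qdata. \<forall>k l. k \<noteq> l \<longrightarrow> (\<forall>v w t. v $ l \<noteq> 0 \<longrightarrow> qA P m *v v = t *\<^sub>R v \<longrightarrow>
      qA P m *v w = t *\<^sub>R w \<longrightarrow> w $ l = 0 \<longrightarrow> w $ k = 0))"
    by (rule generic_all2, rule generic_imp, rule generic_simple_eigenvalue_index)
  then show ?thesis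
  proof (rule generic_mono, intro impI allI)
    fix P :: "'n qdata" and v w t
    assume *: "\<forall>k l. k \<noteq> l \<longrightarrow> (\<forall>v w t. v $ l \<noteq> 0 \<longrightarrow> qA P m *v v = t *\<^sub>R v \<longrightarrow>
      qA P m *v w = t *\<^sub>R w \<longrightarrow> w $ l = 0 \<longrightarrow> w $ k = 0)"
      and v: "v \<noteq> 0" "qA P m *v v = t *\<^sub>R v" and w: "qA P m *v w = t *\<^sub>R w"
    obtain l where l: "v $ l \<noteq> 0" using vec_nonzero_component[OF v(1)] .
    define s where "s = w $ l / v $ l"
    define w' where "w' = w - s *\<^sub>R v"
    have w': "qA P m *v w' = t *\<^sub>R w'" "w' $ l = 0"
      using w v l by (simp_all add: w'_def s_def matrix_vector_mult_diff_distrib matrix_vector_mult_scaleR algebra_simps)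
    have "w' $ k = 0" for k using *[rule_format, OF _ l v(2) w'] w'(2) by metis
    then have "w' = 0" by (simp add: vec_eq_iff)
    then show "\<exists>s. w = s *\<^sub>R v" unfolding w'_def by auto
  qed
qed

section \<open>The boundary of the spectrahedron\<close>

lemma inner_symmetric_matrix:
  fixes A :: "real^'n^'n"
  assumes "\<And>i j. A $ i $ j = A $ j $ i" shows "x \<bullet> (A *v y) = (A *v x) \<bullet> y"
proof -
  have "transpose A = A" using assms by (simp add: vec_eq_iff transpose_def)
  then show ?thesis by (metis dot_lmul_matrix transpose_matrix_vector)
qed

text \<open>If B v were nonzero, a short step from \<open>v\<close> against B v would make the form
  negative, since the first-order term there is negative and the value at \<open>v\<close> is
  0.\<close>

lemma psd_kernel:
  fixes B :: "real^'n^'n"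
  assumes sym: "\<And>i j. B $ i $ j = B $ j $ i" and psd: "\<And>z. z \<bullet> (B *v z) \<ge> 0"
    and v: "v \<bullet> (B *v v) = 0"
  shows "B *v v = 0"
proof (rule ccontr)
  assume ne: "B *v v \<noteq> 0"
  define w where "w = B *v v"
  define b where "b = w \<bullet> w"
  define c where "c = w \<bullet> (B *v w)"
  have b: "b > 0" using ne by (simp add: b_def w_def)
  have c: "c \<ge> 0" using psd by (simp add: c_def)
  \<comment> \<open>The value 2 t b + t^2 c is negative for this t; the summand 1 covers c =
    0.\<close>
  define t where "t = - b / (c + 1)"
  have "0 \<le> (v + t *\<^sub>R w) \<bullet> (B *v (v + t *\<^sub>R w))" by (rule psd)
  also have "\<dots> = 2 * t * b + t * t * c"
    using v inner_symmetric_matrix[OF sym, of v w]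
    by (simp add: matrix_vector_right_distrib matrix_vector_mult_scaleR inner_simps algebra_simps
        b_def c_def w_def)
  also have "\<dots> = t * (b - t)"
  proof -
    have "t * c = - b - t" using c by (simp add: t_def field_simps)
    then have "t * t * c = t * (- b - t)" by (metis mult.assoc)
    then show ?thesis by (simp add: algebra_simps)
  qed
  also have "\<dots> < 0"
  proof -
    have "t < 0" using b c by (simp add: t_def field_simps)
    then show ?thesis using b by (intro mult_neg_pos) auto
  qed
  finally show False by simp
qed

text \<open>By homogeneity unit vectors suffice, and the complement is the projection of a closed
  set along the compact sphere.\<close>

lemma open_positive_definite:
  "open {B::real^'n^'n. \<forall>v. v \<noteq> 0 \<longrightarrow> v \<bullet> (B *v v) > 0}"
proof -
  have cl: "closed {(v, B::real^'n^'n). v \<bullet> (B *v v) \<le> 0}"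
    unfolding case_prod_unfold inner_vec_def matrix_vector_mult_def
    by (intro closed_Collect_le continuous_intros)
  have "{B::real^'n^'n. \<forall>v. v \<noteq> 0 \<longrightarrow> v \<bullet> (B *v v) > 0}
      = - {B. \<exists>v. v \<in> sphere 0 1 \<and> (v, B) \<in> {(v, B). v \<bullet> (B *v v) \<le> 0}}"
  proof (intro set_eqI iffI)
    fix B :: "real^'n^'n"
    assume B: "B \<in> - {B. \<exists>v. v \<in> sphere 0 1 \<and> (v, B) \<in> {(v, B). v \<bullet> (B *v v) \<le> 0}}"
    have "v \<bullet> (B *v v) > 0" if "v \<noteq> 0" for v
    proof -
      have "(1 / norm v) *\<^sub>R v \<in> sphere 0 1" using that by simp
      then have "((1 / norm v) *\<^sub>R v) \<bullet> (B *v ((1 / norm v) *\<^sub>R v)) > 0"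
        using B by (simp only: Compl_iff mem_Collect_eq case_prod_conv) (meson not_le)
      then show ?thesis using that by (simp add: matrix_vector_mult_scaleR zero_less_divide_iff zero_less_mult_iff)
    qed
    then show "B \<in> {B. \<forall>v. v \<noteq> 0 \<longrightarrow> v \<bullet> (B *v v) > 0}" by simp
  next
    fix B :: "real^'n^'n"
    assume "B \<in> {B. \<forall>v. v \<noteq> 0 \<longrightarrow> v \<bullet> (B *v v) > 0}"
    then have *: "v \<bullet> (B *v v) > 0" if "v \<noteq> 0" for v using that by simp
    have False if "norm v = 1" "v \<bullet> (B *v v) \<le> 0" for v using *[of v] that by force
    then show "B \<in> - {B. \<exists>v. v \<in> sphere 0 1 \<and> (v, B) \<in> {(v, B). v \<bullet> (B *v v) \<le> 0}}"
      by auto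
  qed
  then show ?thesis using closed_compact_projection[OF compact_sphere cl, of 0 1] by (simp add: open_Compl)
qed

lemma Sed_eq:
  "Sed P = {l. \<forall>v. v \<noteq> 0 \<longrightarrow> v \<bullet> ((mat 1 - Amat P l) *v v) > 0}"
  by (simp add: Sed_def loewner_less_def Amat_def)

lemma linear_Amat: "linear (Amat P)"
  by (intro linearI) (simp_all add: Amat_def sum.distrib scaleR_add_left scaleR_sum_right)

lemma open_Sed: "open (Sed P)"
proof -
  have "continuous_on UNIV (\<lambda>l. mat 1 - Amat P l)"
    by (intro continuous_intros linear_continuous_on linear_conv_bounded_linear[THEN iffD1] linear_Amat)
  from open_vimage[OF open_positive_definite this] show ?thesis
    by (simp add: Sed_eq vimage_def)
qed

text \<open>Positive semidefiniteness survives limits, and failing to be definite then yields a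
  kernel vector by \<open>psd_kernel\<close>. Conversely \<open>l\<close> is approached along the
  segment from 0, because I - A((1 - s) l) = s I + (1 - s)(I - A(l)) is positive definite for 0 < s
  \<le> 1.\<close>

lemma frontier_Sed:
  assumes P: "symmetric_data P"
  shows "frontier (Sed P) = {l. (\<forall>z. z \<bullet> ((mat 1 - Amat P l) *v z) \<ge> 0) \<and> (\<exists>v. v \<noteq> 0 \<and> Amat P l *v v = v)}"
    (is "_ = ?F")
proof -
  have sym: "(mat 1 - Amat P l) $ i $ j = (mat 1 - Amat P l) $ j $ i" for l i j
    using Amat_sym[OF P] by (simp add: mat_def)
  have cont: "continuous_on UNIV (\<lambda>l. z \<bullet> ((mat 1 - Amat P l) *v z))" for z
  proof -
    have "z \<bullet> ((mat 1 - Amat P l) *v z) = z \<bullet> z - (\<Sum>i\<in>UNIV. l $ i * (z \<bullet> (qA P i *v z)))" for l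
      by (simp add: matrix_vector_mult_diff_rdistrib inner_diff_right Amat_mult inner_sum_right)
    then show ?thesis by (simp only:) (intro continuous_intros)
  qed
  have psd: "z \<bullet> ((mat 1 - Amat P l) *v z) \<ge> 0" if "l \<in> closure (Sed P)" for l z
  proof -
    have "closed {l. z \<bullet> ((mat 1 - Amat P l) *v z) \<ge> 0}"
      by (intro closed_Collect_le cont continuous_on_const)
    moreover have "Sed P \<subseteq> {l. z \<bullet> ((mat 1 - Amat P l) *v z) \<ge> 0}"
      by (cases "z = 0") (auto simp: Sed_eq less_imp_le)
    ultimately show ?thesis using that closure_minimal by blast
  qed
  have fr: "frontier (Sed P) = closure (Sed P) - Sed P"
    by (simp add: frontier_def interior_open open_Sed)
  show ?thesis
  proof (intro set_eqI iffI)
    fix l assume l: "l \<in> frontier (Sed P)"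
    then have p: "z \<bullet> ((mat 1 - Amat P l) *v z) \<ge> 0" for z using psd fr by blast
    obtain v where v: "v \<noteq> 0" "\<not> v \<bullet> ((mat 1 - Amat P l) *v v) > 0"
    proof -
      have "l \<notin> Sed P" using l fr by blast
      then show ?thesis using that unfolding Sed_eq mem_Collect_eq by blast
    qed
    then have "v \<bullet> ((mat 1 - Amat P l) *v v) = 0" using p[of v] by simp
    from psd_kernel[OF sym p this] have "Amat P l *v v = v"
      by (simp add: matrix_vector_mult_diff_rdistrib)
    then show "l \<in> ?F" using p v by blast
  next
    fix l assume "l \<in> ?F"
    then obtain v where p: "\<And>z. z \<bullet> ((mat 1 - Amat P l) *v z) \<ge> 0" and v: "v \<noteq> 0" "Amat P l *v v = v"
      by blast
    have "l \<notin> Sed P" using v unfolding Sed_eq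
      by (auto simp: matrix_vector_mult_diff_rdistrib intro!: exI[of _ v])
    moreover have "l \<in> closure (Sed P)"
    proof -
      have "(\<lambda>n. (1 - inverse (real (Suc n))) *\<^sub>R l) \<longlonglongrightarrow> (1 - 0) *\<^sub>R l"
        by (intro tendsto_intros LIMSEQ_inverse_real_of_nat)
      moreover have "(1 - inverse (real (Suc n))) *\<^sub>R l \<in> Sed P" for n
        unfolding Sed_eq
      proof (intro CollectI allI impI)
        fix z :: "real^'a" assume z: "z \<noteq> 0"
        define s where "s = inverse (real (Suc n))"
        have s: "0 < s" "s \<le> 1" by (auto simp: s_def field_simps)
        have "z \<bullet> ((mat 1 - Amat P ((1 - s) *\<^sub>R l)) *v z)
            = s * (z \<bullet> z) + (1 - s) * (z \<bullet> ((mat 1 - Amat P l) *v z))"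
          unfolding linear_cmul[OF linear_Amat] scaleR_matrix_vector_assoc[symmetric]
            matrix_vector_mult_diff_rdistrib
          by (simp add: inner_diff_right algebra_simps)
        also have "\<dots> > 0" using z s p[of z] by (intro add_pos_nonneg mult_pos_pos mult_nonneg_nonneg) auto
        finally show "z \<bullet> ((mat 1 - Amat P ((1 - inverse (real (Suc n))) *\<^sub>R l)) *v z) > 0"
          by (simp add: s_def)
      qed
      ultimately show ?thesis unfolding closure_sequential
        by (intro exI[of _ "\<lambda>n. (1 - inverse (real (Suc n))) *\<^sub>R l"]) simp
    qed
    ultimately show "l \<in> frontier (Sed P)" using fr by blast
  qed
qed

section \<open>Rational parametrization of the determinantal hypersurface\<close>

lemma polyfun_det:
  "(\<And>i j. (\<lambda>x. M x $ i $ j) \<in> polyfun) \<Longrightarrow> (\<lambda>x. det (M x)) \<in> polyfun"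
  unfolding det_def by (intro polyfun_sum pf_mult pf_const polyfun_prod)

text \<open>The square matrix with columns A_i v, which turns A(l) v = v into a linear system for
  \<open>l\<close> with \<open>v\<close> as parameter.\<close>

definition Lmat :: "'n::finite qdata \<Rightarrow> real^'n \<Rightarrow> real^'n^'n" where
  "Lmat P v = (\<chi> a i. (qA P i *v v) $ a)"

definition kernel_param_num :: "'n::finite qdata \<Rightarrow> 'n \<Rightarrow> real^'n \<Rightarrow> real" where
  "kernel_param_num P k v = det (\<chi> i j. if j = k then v $ i else Lmat P v $ i $ j)"

definition kernel_param :: "'n::finite qdata \<Rightarrow> real^'n \<Rightarrow> real^'n" where
  "kernel_param P v = (\<chi> k. kernel_param_num P k v / det (Lmat P v))"

lemma Lmat_mult: "Lmat P v *v l = Amat P l *v v"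
  unfolding Amat_mult
  by (simp add: vec_eq_iff matrix_vector_mult_def[of "Lmat P v"]) (simp add: Lmat_def mult.commute)

lemma det_Lmat: "det (Lmat P v) \<noteq> 0 \<longleftrightarrow> (\<forall>c. Amat P c *v v = 0 \<longrightarrow> c = 0)"
  by (simp add: matrix_left_invertible_ker Lmat_mult flip: invertible_det_nz invertible_left_inverse)
    (metis invertible_left_inverse matrix_left_invertible_ker Lmat_mult)

lemma kernel_param_unique:
  assumes "det (Lmat P v) \<noteq> 0" shows "Amat P l *v v = v \<longleftrightarrow> l = kernel_param P v"
  using cramer[OF assms, of l v] by (simp add: Lmat_mult kernel_param_def kernel_param_num_def)

lemma polyfun_component: "(\<lambda>x::real^'n. x $ i) \<in> polyfun"
  by (intro polyfun_linear linearI) simp_all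

lemma polyfun_Lmat: "(\<lambda>v. Lmat P v $ i $ j) \<in> polyfun"
  by (simp add: Lmat_def matrix_vector_mult_def polyfun_sum pf_mult pf_const polyfun_component)

lemma polyfun_det_Lmat: "(\<lambda>v. det (Lmat P v)) \<in> polyfun"
  by (intro polyfun_det polyfun_Lmat)

lemma polyfun_kernel_param_num: "kernel_param_num P k \<in> polyfun"
proof -
  have "(\<lambda>v. det (\<chi> i j. if j = k then v $ i else Lmat P v $ i $ j)) \<in> polyfun"
  proof (rule polyfun_det)
    fix i j
    show "(\<lambda>v. (\<chi> i j. if j = k then v $ i else Lmat P v $ i $ j) $ i $ j) \<in> polyfun"
      by (cases "j = k") (simp_all add: polyfun_component polyfun_Lmat)
  qed
  then show ?thesis by (simp add: kernel_param_num_def[abs_def])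
qed

text \<open>Lets a polynomial composed with a rational map be replaced by a genuine polynomial, so
  that the identity principle \<open>polyfun_open_zero\<close> applies to it.\<close>

lemma clear_denominators:
  fixes q :: "real^'n \<Rightarrow> real"
  assumes q: "q \<in> polyfun" and N: "\<And>k. N k \<in> polyfun" and \<Delta>: "\<Delta> \<in> polyfun"
  shows "\<exists>D. \<exists>h\<in>polyfun. \<forall>v. \<Delta> v \<noteq> 0 \<longrightarrow> h v = \<Delta> v ^ D * q (\<chi> k. N k v / \<Delta> v)"
  using q
proof induction
  case (pf_const c)
  then show ?case
    by (intro exI[of _ 0] bexI[of _ "\<lambda>v. c"]) (auto intro: polyfun.intros)
next
  case (pf_coord b)
  then obtain k where "b = axis k 1" by (auto simp: Basis_vec_def)
  then show ?case
    by (intro exI[of _ 1] bexI[of _ "N k"]) (auto simp: N inner_axis)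
next
  case (pf_add p q)
  then obtain D h E g where h: "h \<in> polyfun" "g \<in> polyfun"
    "\<And>v. \<Delta> v \<noteq> 0 \<Longrightarrow> h v = \<Delta> v ^ D * p (\<chi> k. N k v / \<Delta> v)"
    "\<And>v. \<Delta> v \<noteq> 0 \<Longrightarrow> g v = \<Delta> v ^ E * q (\<chi> k. N k v / \<Delta> v)" by metis
  have pow: "(\<lambda>v. \<Delta> v ^ k) \<in> polyfun" for k
    by (induction k) (simp_all add: pf_const pf_mult \<Delta>)
  show ?case
  proof (intro exI[of _ "D + E"] bexI[of _ "\<lambda>v. \<Delta> v ^ E * h v + \<Delta> v ^ D * g v"] allI impI)
    show "(\<lambda>v. \<Delta> v ^ E * h v + \<Delta> v ^ D * g v) \<in> polyfun"
      by (intro polyfun.pf_add polyfun.pf_mult pow h)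
  qed (simp add: h power_add algebra_simps)
next
  case (pf_mult p q)
  then obtain D h E g where h: "h \<in> polyfun" "g \<in> polyfun"
    "\<And>v. \<Delta> v \<noteq> 0 \<Longrightarrow> h v = \<Delta> v ^ D * p (\<chi> k. N k v / \<Delta> v)"
    "\<And>v. \<Delta> v \<noteq> 0 \<Longrightarrow> g v = \<Delta> v ^ E * q (\<chi> k. N k v / \<Delta> v)" by metis
  then show ?case
    by (intro exI[of _ "D + E"] bexI[of _ "\<lambda>v. h v * g v"])
      (auto simp: power_add algebra_simps intro: polyfun.pf_mult)
qed

lemma kernel_param_differentiable:
  assumes "det (Lmat P v) \<noteq> 0" shows "kernel_param P differentiable (at v)"
proof -
  have "kernel_param P = (\<lambda>v. \<Sum>k\<in>UNIV. (kernel_param_num P k v / det (Lmat P v)) *\<^sub>R axis k 1)"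
    by (simp add: fun_eq_iff kernel_param_def vec_eq_iff axis_def if_distrib cong: if_cong)
  moreover have "(\<lambda>v. \<Sum>k\<in>UNIV. (kernel_param_num P k v / det (Lmat P v)) *\<^sub>R (axis k 1 :: real^'a)) differentiable (at v)"
    by (intro differentiable_sum differentiable_scaleR differentiable_divide finite ballI
        differentiable_const polyfun_differentiable polyfun_kernel_param_num polyfun_det_Lmat assms)
  ultimately show ?thesis by simp
qed

text \<open>Maximize the absolute value of v . (A v) on the unit sphere. The absolute value makes
  the maximum t nonzero without assuming a positive eigenvalue, and z . (A z) / t \<le> z . z holds
  for either sign of t. The maximizer is an eigenvector since I - A / t is semidefinite and its form
  vanishes there.\<close>

lemma extremal_eigenvector:
  fixes A :: "real^'n^'n"
  assumes sym: "\<And>i j. A $ i $ j = A $ j $ i" and "A \<noteq> 0"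
  obtains v t where "v \<noteq> 0" "t \<noteq> 0" "A *v v = t *\<^sub>R v" "\<And>z. z \<bullet> ((mat 1 - (1 / t) *\<^sub>R A) *v z) \<ge> 0"
proof -
  have "continuous_on (sphere 0 1) (\<lambda>v. \<bar>v \<bullet> (A *v v)\<bar>)"
    by (intro continuous_intros linear_continuous_on linear_conv_bounded_linear[THEN iffD1]
        matrix_vector_mul_linear)
  from continuous_attains_sup[OF compact_sphere _ this]
  obtain v where v: "norm v = 1" and max: "\<And>z. norm z = 1 \<Longrightarrow> \<bar>z \<bullet> (A *v z)\<bar> \<le> \<bar>v \<bullet> (A *v v)\<bar>"
    by auto
  define t where "t = v \<bullet> (A *v v)"
  have bound: "\<bar>z \<bullet> (A *v z)\<bar> \<le> \<bar>t\<bar> * (z \<bullet> z)" for z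
  proof (cases "z = 0")
    case False
    define y where "y = (1 / norm z) *\<^sub>R z"
    have z: "z = norm z *\<^sub>R y" and "norm y = 1" using False by (simp_all add: y_def)
    have "z \<bullet> (A *v z) = norm z * norm z * (y \<bullet> (A *v y))"
      by (subst (1 2) z) (simp add: matrix_vector_mult_scaleR)
    then have "\<bar>z \<bullet> (A *v z)\<bar> = norm z * norm z * \<bar>y \<bullet> (A *v y)\<bar>" by (simp add: abs_mult)
    also have "\<dots> \<le> norm z * norm z * \<bar>t\<bar>"
      using max[OF \<open>norm y = 1\<close>] by (intro mult_left_mono) (auto simp: t_def)
    finally show ?thesis by (simp add: power2_norm_eq_inner[symmetric] power2_eq_square mult.commute)
  qed simp
  have t: "t \<noteq> 0"
  proof
    assume "t = 0"
    then have "z \<bullet> (A *v z) = 0" for z using bound[of z] by simp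
    then have "A *v z = 0" for z using psd_kernel[OF sym] by (metis order_refl)
    then have "A = 0" by (simp add: matrix_eq)
    then show False using assms by simp
  qed
  let ?B = "mat 1 - (1 / t) *\<^sub>R A"
  have B: "z \<bullet> (?B *v z) = z \<bullet> z - (z \<bullet> (A *v z)) / t" for z
    by (simp add: matrix_vector_mult_diff_rdistrib inner_diff_right flip: scaleR_matrix_vector_assoc)
  have psd: "z \<bullet> (?B *v z) \<ge> 0" for z
  proof -
    have "(z \<bullet> (A *v z)) / t \<le> \<bar>z \<bullet> (A *v z)\<bar> / \<bar>t\<bar>" by (metis abs_divide abs_ge_self)
    also have "\<dots> \<le> z \<bullet> z" using bound[of z] t by (simp add: divide_le_eq mult.commute)
    finally show ?thesis by (simp add: B)
  qed
  have "v \<bullet> (?B *v v) = 0" unfolding B using v t by (simp add: t_def norm_eq_1)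
  moreover have "?B $ i $ j = ?B $ j $ i" for i j using sym[of i j] by (simp add: mat_def)
  ultimately have "?B *v v = 0" using psd_kernel psd by blast
  then have "(1 / t) *\<^sub>R (A *v v) = v"
    by (simp add: matrix_vector_mult_diff_rdistrib flip: scaleR_matrix_vector_assoc)
  then have "t *\<^sub>R ((1 / t) *\<^sub>R (A *v v)) = t *\<^sub>R v" by simp
  then have "A *v v = t *\<^sub>R v" using t by simp
  moreover have "v \<noteq> 0" using v by auto
  ultimately show ?thesis using that t psd by blast
qed

text \<open>Near the kernel vector of a boundary point of corank one, the parametrization stays in the
  boundary; so a polynomial vanishing on the boundary vanishes on the whole parametrized
  hypersurface.\<close>

lemma vanish_on_hypersurface:
  fixes P :: "'n::finite qdata"
  assumes P: "symmetric_data P" and A: "qA P m \<noteq> 0"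
    and E: "\<forall>v t c. v \<noteq> 0 \<longrightarrow> t \<noteq> 0 \<longrightarrow> qA P m *v v = t *\<^sub>R v \<longrightarrow> Amat P c *v v = 0 \<longrightarrow> c = 0"
    and S: "\<forall>v w t. v \<noteq> 0 \<longrightarrow> qA P m *v v = t *\<^sub>R v \<longrightarrow> qA P m *v w = t *\<^sub>R w \<longrightarrow> (\<exists>s. w = s *\<^sub>R v)"
    and q: "q \<in> polyfun" "\<And>l. l \<in> frontier (Sed P) \<Longrightarrow> q l = 0"
    and d: "det (Lmat P d) \<noteq> 0"
  shows "q (kernel_param P d) = 0"
proof -
  obtain v t where v: "v \<noteq> 0" and t: "t \<noteq> 0" and ev: "qA P m *v v = t *\<^sub>R v"
    and psd: "\<And>z. z \<bullet> ((mat 1 - (1 / t) *\<^sub>R qA P m) *v z) \<ge> 0"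
    using extremal_eigenvector[OF symmetric_matD[OF P] A] by blast
  have dv: "det (Lmat P v) \<noteq> 0" using E[rule_format, OF v t ev] by (auto simp: det_Lmat)
  have Am: "Amat P (axis m (1 / t)) = (1 / t) *\<^sub>R qA P m"
    by (simp add: Amat_def axis_def if_distrib[of "\<lambda>c. c *\<^sub>R _"] cong: if_cong)
  have lamv: "kernel_param P v = axis m (1 / t)"
    using kernel_param_unique[OF dv, of "axis m (1 / t)"] ev t by (simp add: Am flip: scaleR_matrix_vector_assoc)
  \<comment> \<open>Semidefiniteness is not an open condition, positive definiteness is. Adding the
    rank-one form of \<open>v\<close> makes I - A(l(v)) definite at the starting point, and it
    changes nothing on the orthogonal complement of \<open>v\<close>, which is all that has to be
    controlled nearby.\<close>
  define T :: "real^'n \<Rightarrow> real^'n^'n" where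
    "T v = mat 1 - Amat P (kernel_param P v) + (\<chi> i j. v $ i * v $ j)" for v
  have outer: "(\<chi> i j. v $ i * v $ j) *v z = (v \<bullet> z) *\<^sub>R v" for v z :: "real^'n"
    by (simp add: vec_eq_iff matrix_vector_mult_def inner_vec_def sum_distrib_left algebra_simps)
  have Tz: "z \<bullet> (T v *v z) = z \<bullet> ((mat 1 - Amat P (kernel_param P v)) *v z) + (v \<bullet> z)\<^sup>2" for v z
    by (simp add: T_def matrix_vector_mult_add_rdistrib inner_add_right outer inner_commute power2_eq_square)
  have Tv: "T v \<in> {B. \<forall>z. z \<noteq> 0 \<longrightarrow> z \<bullet> (B *v z) > 0}"
  proof (intro CollectI allI impI)
    fix z :: "real^'n" assume z: "z \<noteq> 0"
    let ?B = "mat 1 - (1 / t) *\<^sub>R qA P m"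
    have B: "?B = mat 1 - Amat P (kernel_param P v)" by (simp add: lamv Am)
    have sym: "?B $ i $ j = ?B $ j $ i" for i j
      using symmetric_matD[OF P, of m i j] by (simp add: mat_def)
    show "z \<bullet> (T v *v z) > 0"
    proof (rule ccontr)
      assume "\<not> ?thesis"
      then have 0: "z \<bullet> (?B *v z) = 0" "v \<bullet> z = 0"
        using psd[of z] zero_le_power2[of "v \<bullet> z"] unfolding Tz B[symmetric]
        by (smt (verit) power2_eq_iff zero_power2 pos2 power2_less_0 zero_eq_power2)+
      have "?B *v z = 0" using psd_kernel[OF sym psd 0(1)] .
      then have "(1 / t) *\<^sub>R (qA P m *v z) = z"
        by (simp add: matrix_vector_mult_diff_rdistrib flip: scaleR_matrix_vector_assoc)
      then have "t *\<^sub>R ((1 / t) *\<^sub>R (qA P m *v z)) = t *\<^sub>R z" by simp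
      then have "qA P m *v z = t *\<^sub>R z" using t by simp
      then obtain s where "z = s *\<^sub>R v" using S[rule_format, OF v ev] by blast
      then show False using 0 z v by simp
    qed
  qed
  have lcont: "isCont (kernel_param P) v"
    using kernel_param_differentiable[OF dv] differentiable_imp_continuous_within by blast
  have "isCont (\<lambda>v. Amat P (kernel_param P v)) v"
    using lcont by (intro isCont_o2[OF lcont] linear_continuous_at linear_conv_bounded_linear[THEN iffD1] linear_Amat)
  moreover have "continuous_on UNIV (\<lambda>v::real^'n. \<chi> i j. v $ i * v $ j)"
    by (intro continuous_on_vec_lambda continuous_intros)
  then have "isCont (\<lambda>v::real^'n. \<chi> i j. v $ i * v $ j) v"
    by (simp add: continuous_on_eq_continuous_at)
  ultimately have "isCont T v"
    unfolding T_def by (intro continuous_add continuous_diff continuous_const)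
  then have "(T \<longlongrightarrow> T v) (nhds v)" by (simp add: isCont_def tendsto_at_iff_tendsto_nhds)
  then have ev1: "eventually (\<lambda>v. T v \<in> {B. \<forall>z. z \<noteq> 0 \<longrightarrow> z \<bullet> (B *v z) > 0}) (nhds v)"
    using open_positive_definite Tv by (rule topological_tendstoD)
  have "((\<lambda>v. det (Lmat P v)) \<longlongrightarrow> det (Lmat P v)) (nhds v)"
    using polyfun_continuous[OF polyfun_det_Lmat[of P], of v]
    by (simp add: isCont_def tendsto_at_iff_tendsto_nhds[of "\<lambda>v. det (Lmat P v)"])
  then have ev2: "eventually (\<lambda>v. det (Lmat P v) \<noteq> 0) (nhds v)"
    using dv by (rule tendsto_imp_eventually_ne)
  obtain U where U: "open U" "v \<in> U" "\<And>v. v \<in> U \<Longrightarrow> det (Lmat P v) \<noteq> 0"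
    "\<And>v z. v \<in> U \<Longrightarrow> z \<noteq> 0 \<Longrightarrow> z \<bullet> (T v *v z) > 0"
    using eventually_conj[OF ev1 ev2] unfolding eventually_nhds by auto
  have "q (kernel_param P u) = 0" if u: "u \<in> U" for u
  proof (rule q(2), unfold frontier_Sed[OF P], intro CollectI conjI allI exI)
    have ku: "Amat P (kernel_param P u) *v u = u" using kernel_param_unique[OF U(3)[OF u]] by simp
    show "Amat P (kernel_param P u) *v u = u" by (rule ku)
    show u0: "u \<noteq> 0"
      using U(3)[OF u] unfolding det_Lmat by (metis matrix_vector_mult_0_right axis_eq_0_iff zero_neq_one)
    fix z
    let ?B = "mat 1 - Amat P (kernel_param P u)"
    have Bu: "?B *v u = 0" using ku by (simp add: matrix_vector_mult_diff_rdistrib)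
    have sym: "?B $ i $ j = ?B $ j $ i" for i j using Amat_sym[OF P] by (simp add: mat_def)
    \<comment> \<open>The part of \<open>z\<close> orthogonal to \<open>u\<close>: the form ignores
      the component along \<open>u\<close>, and on \<open>y\<close> it agrees with the form of
      \<open>T u\<close>.\<close>
    define y where "y = z - ((u \<bullet> z) / (u \<bullet> u)) *\<^sub>R u"
    have uy: "u \<bullet> y = 0" using u0 by (simp add: y_def inner_diff_right)
    have "?B *v z = ?B *v y"
      unfolding y_def matrix_vector_mult_diff_distrib matrix_vector_mult_scaleR Bu by simp
    moreover have "z \<bullet> (?B *v y) = y \<bullet> (?B *v y)"
    proof -
      have "u \<bullet> (?B *v y) = 0" using inner_symmetric_matrix[OF sym, of u y] Bu by simp
      moreover have "z = y + ((u \<bullet> z) / (u \<bullet> u)) *\<^sub>R u" by (simp add: y_def)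
      then have "z \<bullet> (?B *v y) = y \<bullet> (?B *v y) + ((u \<bullet> z) / (u \<bullet> u)) * (u \<bullet> (?B *v y))"
        by (metis inner_add_left inner_scaleR_left)
      ultimately show ?thesis by simp
    qed
    moreover have "y \<bullet> (?B *v y) \<ge> 0"
      using U(4)[OF u, of y] uy by (cases "y = 0") (auto simp: Tz)
    ultimately show "z \<bullet> (?B *v z) \<ge> 0" by simp
  qed
  note vanish = this
  \<comment> \<open>Without denominators, vanishing on \<open>U\<close> spreads to all of space, in
    particular to \<open>d\<close>.\<close>
  have "\<exists>D. \<exists>h\<in>polyfun. \<forall>v. det (Lmat P v) \<noteq> 0 \<longrightarrow> h v = det (Lmat P v) ^ D * q (kernel_param P v)"
    unfolding kernel_param_def by (rule clear_denominators[OF q(1) polyfun_kernel_param_num polyfun_det_Lmat])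
  then obtain D h where h: "h \<in> polyfun"
    "\<And>v. det (Lmat P v) \<noteq> 0 \<Longrightarrow> h v = det (Lmat P v) ^ D * q (kernel_param P v)" by blast
  have "h u = 0" if "u \<in> U" for u using that U(3) vanish h(2) by simp
  then have "h d = 0" using polyfun_open_zero[OF h(1) U(1,2)] by blast
  then show ?thesis using h(2)[OF d] d by simp
qed

section \<open>Tangent spaces\<close>

lemma bounded_bilinear_Amat: "bounded_bilinear (\<lambda>l v. Amat P l *v v)"
  unfolding bilinear_conv_bounded_bilinear[symmetric] bilinear_def
  by (intro conjI allI matrix_vector_mul_linear linearI)
    (simp_all add: linear_add[OF linear_Amat] linear_cmul[OF linear_Amat]
      matrix_vector_mult_add_rdistrib flip: scaleR_matrix_vector_assoc)

text \<open>For \<open>M = I - A(\<lambda>)\<close> with kernel spanned by \<open>d\<close>, the map \<open>M + d d\<^sup>T\<close> is injective, so the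
  range of \<open>M\<close> is the hyperplane orthogonal to \<open>d\<close>.\<close>

lemma range_orthogonal_kernel:
  fixes M :: "real^'n^'n"
  assumes sym: "\<And>i j. M $ i $ j = M $ j $ i" and d: "d \<noteq> 0" "M *v d = 0"
    and ker: "\<And>w. M *v w = 0 \<Longrightarrow> \<exists>s. w = s *\<^sub>R d" and y: "d \<bullet> y = 0"
  obtains w where "M *v w = y"
proof -
  define T where "T w = M *v w + (d \<bullet> w) *\<^sub>R d" for w
  have dM: "d \<bullet> (M *v w) = 0" for w
    using inner_symmetric_matrix[OF sym, of d w] d by simp
  have dT: "d \<bullet> T w = (d \<bullet> w) * (d \<bullet> d)" for w by (simp add: T_def inner_add_right dM)
  have lin: "linear T"
    by (intro linearI) (simp_all add: T_def matrix_vector_right_distrib matrix_vector_mult_scaleR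
        inner_add_right algebra_simps)
  have "inj T"
    unfolding linear_injective_0[OF lin]
  proof (intro allI impI)
    fix w assume w: "T w = 0"
    then have dw: "d \<bullet> w = 0" using dT[of w] d by simp
    then have "M *v w = 0" using w by (simp add: T_def)
    then obtain s where "w = s *\<^sub>R d" using ker by blast
    then show "w = 0" using dw d by simp
  qed
  then have "surj T" using lin by (simp add: linear_injective_imp_surjective)
  then obtain w where w: "T w = y" by (metis surjD)
  then have "d \<bullet> w = 0" using dT[of w] y d by simp
  then show ?thesis using w that by (simp add: T_def)
qed

text \<open>Differentiating A(l(v)) v = v at d in direction w gives A(Dw) d = (I - A) w. As A(l) d
  is orthogonal to the kernel vector d, some w has (I - A) w = A(l) d, and independence of the
  columns A_i d forces Dw = l. So \<open>l\<close> is a velocity of the parametrization, along which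
  \<open>q\<close> is constantly 0.\<close>

lemma hypersurface_tangent:
  fixes P :: "'n::finite qdata"
  assumes P: "symmetric_data P" and det: "det (Lmat P d) \<noteq> 0" and d: "d \<noteq> 0"
    and ker: "\<And>w. Amat P (kernel_param P d) *v w = w \<Longrightarrow> \<exists>s. w = s *\<^sub>R d"
    and q: "q \<in> polyfun" "\<And>v. det (Lmat P v) \<noteq> 0 \<Longrightarrow> q (kernel_param P v) = 0"
    and l: "d \<bullet> (Amat P l *v d) = 0"
  shows "frechet_derivative q (at (kernel_param P d)) l = 0"
proof -
  let ?A = "Amat P (kernel_param P d)"
  have Ad: "?A *v d = d" using kernel_param_unique[OF det] by simp
  obtain w where w: "(mat 1 - ?A) *v w = Amat P l *v d"
  proof (rule range_orthogonal_kernel[OF _ d _ _ l])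
    show "(mat 1 - ?A) $ i $ j = (mat 1 - ?A) $ j $ i" for i j
      using Amat_sym[OF P] by (simp add: mat_def)
  qed (use ker Ad in \<open>simp_all add: matrix_vector_mult_diff_rdistrib\<close>)
  obtain D where D: "(kernel_param P has_derivative D) (at d)"
    using kernel_param_differentiable[OF det] unfolding differentiable_def by blast
  have cont: "continuous_on UNIV (\<lambda>v. det (Lmat P v))"
    by (intro continuous_at_imp_continuous_on ballI polyfun_continuous polyfun_det_Lmat)
  define U where "U = {v. det (Lmat P v) \<noteq> 0}"
  have U: "open U" "d \<in> U"
    unfolding U_def using det by (auto intro!: open_Collect_neq cont continuous_on_const)
  have "((\<lambda>v. Amat P (kernel_param P v) *v v) has_derivative (\<lambda>h. ?A *v h + Amat P (D h) *v d)) (at d)"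
    by (rule bounded_bilinear.FDERIV[OF bounded_bilinear_Amat D has_derivative_ident])
  moreover have "((\<lambda>v. Amat P (kernel_param P v) *v v) has_derivative (\<lambda>h. h)) (at d)"
    by (rule has_derivative_transform_within_open[OF has_derivative_ident U])
      (simp add: U_def kernel_param_unique[THEN iffD2, OF _ refl])
  ultimately have "(\<lambda>h. ?A *v h + Amat P (D h) *v d) = (\<lambda>h. h)"
    by (rule has_derivative_unique)
  from fun_cong[OF this, of w] have "Amat P (D w) *v d = w - ?A *v w" by (metis add_diff_cancel_left')
  then have "Amat P (D w) *v d = Amat P l *v d"
    using w by (simp add: matrix_vector_mult_diff_rdistrib)
  then have "Amat P (D w - l) *v d = 0"
    by (simp add: linear_diff[OF linear_Amat] matrix_vector_mult_diff_rdistrib)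
  then have Dw: "D w = l" using det unfolding det_Lmat by auto
  have "((\<lambda>v. q (kernel_param P v)) has_derivative (\<lambda>h. frechet_derivative q (at (kernel_param P d)) (D h))) (at d)"
    by (rule has_derivative_compose[OF D polyfun_has_derivative[OF q(1)]])
  moreover have "((\<lambda>v. q (kernel_param P v)) has_derivative (\<lambda>h. 0)) (at d)"
    by (rule has_derivative_transform_within_open[OF has_derivative_const U])
      (simp add: U_def q(2))
  ultimately have "(\<lambda>h. frechet_derivative q (at (kernel_param P d)) (D h)) = (\<lambda>h. 0)"
    by (rule has_derivative_unique)
  from fun_cong[OF this, of w] show ?thesis by (simp add: Dw)
qed

lemma matrix_mult_diff_scaleR:
  fixes A B C :: "real^'n^'n"
  shows "(A - c *\<^sub>R B) ** C = A ** C - c *\<^sub>R (B ** C)" "A ** (B - c *\<^sub>R C) = A ** B - c *\<^sub>R (A ** C)"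
  by (simp_all add: matrix_eq matrix_vector_mult_diff_rdistrib matrix_vector_mult_diff_distrib
      matrix_vector_mult_scaleR flip: matrix_vector_mul_assoc scaleR_matrix_vector_assoc)

text \<open>An orthogonal matrix carrying the basis vector at \<open>k\<close> to \<open>d\<close>
  conjugates the rank-one projection to a diagonal matrix with a single 1.\<close>

lemma det_identity_minus_rank_one:
  fixes d :: "real^'n"
  assumes "norm d = 1"
  shows "det (mat 1 - c *\<^sub>R (\<chi> i j. d $ i * d $ j)) = 1 - c"
proof -
  fix k :: 'n
  obtain Q :: "real^'n^'n" where Q: "orthogonal_matrix Q" "Q *v axis k 1 = d"
    using orthogonal_matrix_exists_basis[OF assms] by blast
  define F :: "real^'n^'n" where "F = (\<chi> i j. if i = k \<and> j = k then 1 else 0)"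
  let ?E = "\<chi> i j. d $ i * d $ j"
  have Qk: "Q $ i $ k = d $ i" for i
    using Q(2) by (auto simp: vec_eq_iff matrix_vector_mult_basis column_def)
  have QF: "Q ** F = (\<chi> i j. if j = k then d $ i else 0)"
    by (simp add: vec_eq_iff F_def matrix_matrix_mult_def Qk if_distrib cong: if_cong)
  have dQ: "(\<Sum>j\<in>UNIV. d $ j * Q $ j $ b) = (if b = k then 1 else 0)" for b
  proof -
    have "(transpose Q ** Q) $ k $ b = (mat 1 :: real^'n^'n) $ k $ b"
      using Q(1) by (simp add: orthogonal_matrix_def)
    then show ?thesis by (simp add: matrix_matrix_mult_def transpose_def Qk mat_def eq_commute)
  qed
  have "?E ** Q = Q ** F"
    unfolding QF by (simp add: vec_eq_iff matrix_matrix_mult_def mult.assoc dQ flip: sum_distrib_left)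
  then have "(mat 1 - c *\<^sub>R ?E) ** Q = Q ** (mat 1 - c *\<^sub>R F)"
    by (simp add: matrix_mult_diff_scaleR)
  then have "det (mat 1 - c *\<^sub>R ?E) * det Q = det Q * det (mat 1 - c *\<^sub>R F)" by (metis det_mul)
  moreover have "det Q \<noteq> 0" using det_orthogonal_matrix[OF Q(1)] by auto
  moreover have "det (mat 1 - c *\<^sub>R F) = 1 - c"
  proof -
    have "(mat 1 - c *\<^sub>R F) $ i $ j = 0" if "i \<noteq> j" for i j
      using that by (auto simp: F_def mat_def)
    then have "det (mat 1 - c *\<^sub>R F) = (\<Prod>i\<in>UNIV. (mat 1 - c *\<^sub>R F) $ i $ i)"
      by (rule det_diagonal)
    also have "\<dots> = (\<Prod>i\<in>UNIV. if i = k then 1 - c else 1)"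
      by (rule prod.cong) (simp_all add: F_def mat_def)
    finally show ?thesis by (simp add: prod.delta)
  qed
  ultimately show ?thesis by simp
qed

text \<open>With \<open>E\<close> the orthogonal projection onto the kernel of \<open>I - A\<close> and
  \<open>N(s) = I - (1 + s) A + (1 + s) E\<close> one has \<open>I - (1 + s) A = N(s) (I - (1 + s) E)\<close>, whose
  determinant is \<open>- s det N(s)\<close>, and \<open>N(0)\<close> is invertible.\<close>

lemma det_derivative_nonzero:
  fixes A :: "real^'n^'n"
  assumes sym: "\<And>i j. A $ i $ j = A $ j $ i" and d: "d \<noteq> 0" "A *v d = d"
    and ker: "\<And>w. A *v w = w \<Longrightarrow> \<exists>s. w = s *\<^sub>R d"
  shows "\<exists>c. c \<noteq> 0 \<and> ((\<lambda>s. det (mat 1 - (1 + s) *\<^sub>R A)) has_real_derivative c) (at 0)"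
proof -
  define e where "e = (1 / norm d) *\<^sub>R d"
  have e: "norm e = 1" "A *v e = e" using d by (simp_all add: e_def matrix_vector_mult_scaleR)
  define E :: "real^'n^'n" where "E = (\<chi> i j. e $ i * e $ j)"
  have Ev: "E *v z = (e \<bullet> z) *\<^sub>R e" for z
    by (simp add: E_def vec_eq_iff matrix_vector_mult_def inner_vec_def sum_distrib_left algebra_simps)
  have AE: "A ** E = E"
    unfolding matrix_eq matrix_vector_mul_assoc[symmetric] Ev by (simp add: matrix_vector_mult_scaleR e)
  have EE: "E ** E = E"
    unfolding matrix_eq matrix_vector_mul_assoc[symmetric] Ev
    using e(1) by (simp add: matrix_vector_mult_scaleR norm_eq_1)
  define N where "N s = mat 1 - (1 + s) *\<^sub>R A + (1 + s) *\<^sub>R E" for s :: real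
  have NE: "N s ** E = E" for s
    unfolding matrix_eq matrix_vector_mul_assoc[symmetric] Ev N_def
    using e by (simp add: matrix_vector_mult_scaleR matrix_vector_mult_diff_rdistrib
        matrix_vector_mult_add_rdistrib Ev norm_eq_1 flip: scaleR_matrix_vector_assoc)
  have "N s ** (mat 1 - (1 + s) *\<^sub>R E) = mat 1 - (1 + s) *\<^sub>R A" for s
    unfolding matrix_mult_diff_scaleR NE by (simp add: N_def)
  then have fac: "det (mat 1 - (1 + s) *\<^sub>R A) = - s * det (N s)" for s
    by (metis E_def add_diff_cancel_left' det_identity_minus_rank_one[OF e(1)] det_mul
        diff_add_cancel minus_diff_eq mult.commute)
  have "\<forall>z. N 0 *v z = 0 \<longrightarrow> z = 0"
  proof (intro allI impI)
    fix z assume "N 0 *v z = 0"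
    then have z: "z - A *v z + (e \<bullet> z) *\<^sub>R e = 0"
      by (simp add: N_def matrix_vector_mult_diff_rdistrib matrix_vector_mult_add_rdistrib Ev)
    have "0 = e \<bullet> (z - A *v z + (e \<bullet> z) *\<^sub>R e)" by (simp add: z)
    also have "\<dots> = e \<bullet> z"
      using inner_symmetric_matrix[OF sym, of e z] e by (simp add: inner_simps norm_eq_1)
    finally have ez: "e \<bullet> z = 0" by simp
    then have "A *v z = z" using z by simp
    then obtain s where "z = s *\<^sub>R d" using ker by blast
    then show "z = 0" using ez d by (simp add: e_def)
  qed
  then have N0: "det (N 0) \<noteq> 0"
    by (metis invertible_det_nz invertible_left_inverse matrix_left_invertible_ker)
  have "(\<lambda>s. det (N s)) \<in> polyfun"
  proof (rule polyfun_det)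
    fix i j
    have id: "(\<lambda>s::real. s) \<in> polyfun" by (intro polyfun_linear linear_ident)
    show "(\<lambda>s. N s $ i $ j) \<in> polyfun"
      unfolding N_def by (simp add: polyfun_diff pf_add pf_mult pf_const id)
  qed
  then obtain c where c: "((\<lambda>s. det (N s)) has_real_derivative c) (at 0)"
    using polyfun_differentiable real_differentiable_def by blast
  have "((\<lambda>s. - s * det (N s)) has_real_derivative (- 1 * det (N 0) + c * (- 0))) (at 0)"
    by (intro DERIV_mult c derivative_intros)
  then have "((\<lambda>s. det (mat 1 - (1 + s) *\<^sub>R A)) has_real_derivative - det (N 0)) (at 0)"
    by (simp add: fac)
  then show ?thesis using N0 by (metis neg_equal_0_iff_equal)
qed

text \<open>One nonzero directional derivative suffices to see that the determinant has a nonzero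
  differential, and the radial direction is the computable one.\<close>

lemma frechet_scaled:
  fixes q :: "'a::euclidean_space \<Rightarrow> real"
  assumes q: "q \<in> polyfun" and c: "((\<lambda>s. q ((1 + s) *\<^sub>R l)) has_real_derivative c) (at 0)"
  shows "frechet_derivative q (at l) l = c"
proof -
  have "((\<lambda>s. (1 + s) *\<^sub>R l) has_derivative (\<lambda>h. h *\<^sub>R l)) (at (0::real))"
    by (auto intro!: derivative_eq_intros)
  from has_derivative_compose[OF this, of q] polyfun_has_derivative[OF q, of l]
  have "((\<lambda>s. q ((1 + s) *\<^sub>R l)) has_derivative (\<lambda>h. frechet_derivative q (at l) (h *\<^sub>R l))) (at 0)"
    by simp
  from fun_cong[OF has_derivative_unique[OF this c[unfolded has_field_derivative_def]], of 1]
  show ?thesis by simp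
qed

section \<open>Zariski tangent spaces of the bisector and of the boundaries\<close>

lemma vanishing_ideal_zariski_closure: "vanishing_ideal (zariski_closure S) = vanishing_ideal S"
  unfolding vanishing_ideal_def zariski_closure_def by auto

lemma frontier_affine_image:
  fixes J :: "'a::euclidean_space \<Rightarrow> 'a"
  assumes J: "linear J" "inj J"
  shows "frontier ((\<lambda>l. x - J l) ` S) = (\<lambda>l. x - J l) ` frontier S"
proof -
  have lin: "linear (\<lambda>l. - J l)" using J by (simp add: linear_compose_neg)
  have inj: "inj (\<lambda>l. - J l)" using J by (simp add: inj_def)
  have "(\<lambda>l. x - J l) ` T = (+) x ` ((\<lambda>l. - J l) ` T)" for T by (simp add: image_image)
  moreover have "frontier ((\<lambda>l. - J l) ` S) = (\<lambda>l. - J l) ` frontier S"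
    unfolding frontier_def
    by (simp add: closure_injective_linear_image[OF lin inj] interior_injective_linear_image[OF lin inj]
        image_set_diff[OF inj])
  ultimately show ?thesis by (simp add: frontier_translation)
qed

lemma qf_has_derivative:
  assumes "symmetric_data P"
  shows "(qf P j has_derivative (\<lambda>h. 2 * (Bvec P x j \<bullet> h))) (at x)"
proof -
  have sym: "x \<bullet> (qA P j *v h) = (qA P j *v x) \<bullet> h" for h
    by (rule inner_symmetric_matrix) (rule symmetric_matD[OF assms])
  have mul: "((\<lambda>x. qA P j *v x) has_derivative (\<lambda>h. qA P j *v h)) (at x)"
    by (rule linear_imp_has_derivative) (rule matrix_vector_mul_linear)
  show ?thesis unfolding qf_def[abs_def]
    by (rule has_derivative_eq_rhs, (rule derivative_intros mul)+)
      (simp add: fun_eq_iff sym Bvec_def inner_simps inner_commute algebra_simps)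
qed

lemma Jacf_mult:
  assumes "symmetric_data P"
  shows "(1 / 2) *\<^sub>R (Jacf P x *v l) = (\<Sum>j\<in>UNIV. l $ j *\<^sub>R Bvec P x j)"
proof -
  have "frechet_derivative (qf P j) (at x) = (\<lambda>h. 2 * (Bvec P x j \<bullet> h))" for j
    using frechet_derivative_at[OF qf_has_derivative[OF assms]] by metis
  then have "Jacf P x $ i $ j = 2 * Bvec P x j $ i" for i j
    by (simp add: Jacf_def inner_axis)
  then show ?thesis
    by (simp add: vec_eq_iff matrix_vector_mult_def sum_distrib_left algebra_simps)
qed

text \<open>The defining affine function bounds the tangent space from above; from below, the line
  through \<open>u\<close> in direction \<open>v\<close> stays in the hyperplane, so every vanishing
  polynomial is constant on it.\<close>

lemma zariski_tangent_hyperplane: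
  fixes d u :: "'a::euclidean_space"
  assumes u: "d \<bullet> u = c"
  shows "zariski_tangent {y. d \<bullet> y = c} u = {v. d \<bullet> v = 0}"
proof (intro set_eqI iffI)
  fix v assume v: "v \<in> zariski_tangent {y. d \<bullet> y = c} u"
  have "linear (\<lambda>y. d \<bullet> y)" by (intro linearI) (simp_all add: inner_add_right)
  then have "(\<lambda>y. d \<bullet> y - c) \<in> vanishing_ideal {y. d \<bullet> y = c}"
    by (simp add: vanishing_ideal_def polyfun_diff polyfun_linear pf_const)
  then have "frechet_derivative (\<lambda>y. d \<bullet> y - c) (at u) v = 0"
    using v by (simp add: zariski_tangent_def)
  moreover have "((\<lambda>y. d \<bullet> y - c) has_derivative (\<lambda>v. d \<bullet> v)) (at u)"
    by (auto intro!: derivative_eq_intros)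
  ultimately show "v \<in> {v. d \<bullet> v = 0}" by (simp add: frechet_derivative_at[symmetric])
next
  fix v assume v: "v \<in> {v. d \<bullet> v = 0}"
  show "v \<in> zariski_tangent {y. d \<bullet> y = c} u"
    unfolding zariski_tangent_def
  proof (intro CollectI ballI)
    fix p assume p: "p \<in> vanishing_ideal {y. d \<bullet> y = c}"
    then have pp: "p \<in> polyfun" by (simp add: vanishing_ideal_def)
    have "((\<lambda>s. u + s *\<^sub>R v) has_derivative (\<lambda>h. h *\<^sub>R v)) (at (0::real))"
      by (auto intro!: derivative_eq_intros)
    from has_derivative_compose[OF this, of p] polyfun_has_derivative[OF pp, of u]
    have "((\<lambda>s. p (u + s *\<^sub>R v)) has_derivative (\<lambda>h. frechet_derivative p (at u) (h *\<^sub>R v))) (at (0::real))"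
      by simp
    moreover have "(\<lambda>s. p (u + s *\<^sub>R v)) = (\<lambda>s. 0)"
      using p u v by (simp add: vanishing_ideal_def inner_add_right)
    ultimately have "(\<lambda>h. frechet_derivative p (at u) (h *\<^sub>R v)) = (\<lambda>h::real. 0)"
      using has_derivative_unique has_derivative_const by metis
    from fun_cong[OF this, of 1] show "frechet_derivative p (at u) v = 0" by simp
  qed
qed

lemma bisector_eq: "bisector x x' = {u. (x' - x) \<bullet> u = (x' \<bullet> x' - x \<bullet> x) / 2}"
proof -
  have "dist u x = dist u x' \<longleftrightarrow> (u - x) \<bullet> (u - x) = (u - x') \<bullet> (u - x')" for u
    by (simp add: dist_norm norm_eq)
  also have "\<dots> u \<longleftrightarrow> (x' - x) \<bullet> u = (x' \<bullet> x' - x \<bullet> x) / 2" for u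
    by (auto simp: inner_diff_left inner_diff_right inner_commute field_simps)
  finally show ?thesis by (simp add: bisector_def)
qed

lemma Bvec_difference:
  assumes "symmetric_data P" "x \<in> Vf P" "x' \<in> Vf P"
  shows "(x' - x) \<bullet> (\<Sum>j\<in>UNIV. l $ j *\<^sub>R Bvec P x j) = - ((x' - x) \<bullet> (Amat P l *v (x' - x))) / 2"
proof -
  have "(x' - x) \<bullet> Bvec P x j = - ((x' - x) \<bullet> (qA P j *v (x' - x))) / 2" for j
    using Vf_difference[OF assms, of j] by simp
  then show ?thesis
    by (simp add: Amat_mult inner_sum_right sum_negf sum_divide_distrib)
qed

text \<open>Everything is pulled back along the affine bijection from the l-space. The
  parametrization puts all of the orthogonal complement of d into the tangent space, and the
  determinant shows that nothing else belongs to it. The roles of x and x' can be exchanged, so one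
  statement serves both boundaries.\<close>

lemma alg_boundary_Sx:
  fixes P :: "'n::finite qdata"
  assumes P: "symmetric_data P" and x: "x \<in> Vf P" "x' \<in> Vf P" "x \<noteq> x'"
    and Jac: "\<forall>c::real^'n. (\<Sum>j\<in>UNIV. c $ j *\<^sub>R Bvec P x j) = 0 \<longrightarrow> c = 0"
    and col: "\<forall>c. Amat P c *v (x' - x) = 0 \<longrightarrow> c = 0"
    and ker: "\<forall>c w. Amat P c *v (x' - x) = x' - x \<longrightarrow> Amat P c *v w = w \<longrightarrow> (\<exists>s. w = s *\<^sub>R (x' - x))"
    and E: "\<forall>v t c. v \<noteq> 0 \<longrightarrow> t \<noteq> 0 \<longrightarrow> qA P m *v v = t *\<^sub>R v \<longrightarrow> Amat P c *v v = 0 \<longrightarrow> c = 0"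
    and S: "\<forall>v w t. v \<noteq> 0 \<longrightarrow> qA P m *v v = t *\<^sub>R v \<longrightarrow> qA P m *v w = t *\<^sub>R w \<longrightarrow> (\<exists>s. w = s *\<^sub>R v)"
    and l: "Amat P l *v (x' - x) = x' - x"
    and u: "u = x - (\<Sum>j\<in>UNIV. l $ j *\<^sub>R Bvec P x j)"
  shows "u \<in> alg_boundary (Sx P x)"
    and "zariski_tangent (alg_boundary (Sx P x)) u = {v. (x' - x) \<bullet> v = 0}"
proof -
  define d where "d = x' - x"
  have d0: "d \<noteq> 0" using x by (simp add: d_def)
  have det: "det (Lmat P d) \<noteq> 0" using col by (auto simp: det_Lmat d_def)
  have ld: "l = kernel_param P d" using kernel_param_unique[OF det] l by (simp add: d_def)
  define J where "J c = (\<Sum>j\<in>UNIV. c $ j *\<^sub>R Bvec P x j)" for c :: "real^'n"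
  have linJ: "linear J"
    unfolding J_def by (intro linearI) (simp_all add: scaleR_add_left sum.distrib scaleR_sum_right)
  have injJ: "inj J" unfolding linear_injective_0[OF linJ] using Jac by (simp add: J_def)
  obtain K where K: "linear K" "\<And>c. K (J c) = c" "\<And>y. J (K y) = y"
    using linear_injective_isomorphism[OF linJ injJ] by blast
  have dJ: "d \<bullet> J c = - (d \<bullet> (Amat P c *v d)) / 2" for c
    using Bvec_difference[OF P x(1,2)] by (simp add: d_def J_def)
  define \<phi> where "\<phi> c = x - J c" for c
  have ul: "u = \<phi> l" by (simp add: u \<phi>_def J_def)
  have "Sx P x = \<phi> ` Sed P"
    by (auto simp: Sx_def \<phi>_def J_def Jacf_mult[OF P])
  then have frS: "frontier (Sx P x) = \<phi> ` frontier (Sed P)"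
    using frontier_affine_image[OF linJ injJ] by (simp add: \<phi>_def[abs_def])
  \<comment> \<open>A zero matrix A_m would be a zero column among the independent vectors A_i
    d.\<close>
  have A0: "qA P m \<noteq> 0"
  proof
    assume "qA P m = 0"
    then have "Amat P (axis m 1) *v (x' - x) = 0"
      by (simp add: Amat_mult axis_def if_distrib[of "\<lambda>c. c *\<^sub>R _"] cong: if_cong)
    then show False using col axis_eq_0_iff zero_neq_one by metis
  qed
  have \<phi>_der: "(\<phi> has_derivative (\<lambda>h. - J h)) (at l)"
    unfolding \<phi>_def by (auto intro!: derivative_eq_intros linear_imp_has_derivative[OF linJ])
  have comp_polyfun: "(\<lambda>c. p (\<phi> c)) \<in> polyfun" if "p \<in> polyfun" for p :: "real^'n \<Rightarrow> real"
  proof (rule polyfun_compose[OF that])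
    fix b :: "real^'n"
    have "linear (\<lambda>c. J c \<bullet> b)"
      using linJ by (intro linearI) (simp_all add: linear_add linear_cmul inner_add_left)
    then show "(\<lambda>c. \<phi> c \<bullet> b) \<in> polyfun"
      by (simp add: \<phi>_def inner_diff_left polyfun_diff pf_const polyfun_linear)
  qed
  have vanish: "p (\<phi> (kernel_param P v)) = 0" if "p \<in> vanishing_ideal (frontier (Sx P x))" "det (Lmat P v) \<noteq> 0" for p v
  proof (rule vanish_on_hypersurface[where q = "\<lambda>c. p (\<phi> c)", OF P A0 E S _ _ that(2)])
    show "(\<lambda>c. p (\<phi> c)) \<in> polyfun" using that by (intro comp_polyfun) (simp add: vanishing_ideal_def)
    show "p (\<phi> c) = 0" if "c \<in> frontier (Sed P)" for c
      using that \<open>p \<in> vanishing_ideal _\<close> by (simp add: vanishing_ideal_def frS)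
  qed
  show "u \<in> alg_boundary (Sx P x)"
    unfolding alg_boundary_def zariski_closure_def
    using vanish[OF _ det] by (simp add: ul ld)
  have tangent: "frechet_derivative p (at u) v = 0"
    if p: "p \<in> vanishing_ideal (frontier (Sx P x))" and v: "d \<bullet> v = 0" for p v
  proof -
    have pp: "p \<in> polyfun" using p by (simp add: vanishing_ideal_def)
    have comp: "((\<lambda>c. p (\<phi> c)) has_derivative (\<lambda>h. frechet_derivative p (at u) (- J h))) (at l)"
      using has_derivative_compose[OF \<phi>_der, of p] polyfun_has_derivative[OF pp, of u] by (simp add: ul)
    have qp: "(\<lambda>c. p (\<phi> c)) \<in> polyfun" by (rule comp_polyfun[OF pp])
    have "frechet_derivative (\<lambda>c. p (\<phi> c)) (at (kernel_param P d)) (K (- v)) = 0"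
    proof (rule hypersurface_tangent[OF P det d0 _ qp])
      show "\<exists>s. w = s *\<^sub>R d" if "Amat P (kernel_param P d) *v w = w" for w
        using ker l that by (simp add: ld d_def)
      show "p (\<phi> (kernel_param P v)) = 0" if "det (Lmat P v) \<noteq> 0" for v using vanish[OF p that] .
      show "d \<bullet> (Amat P (K (- v)) *v d) = 0" using dJ[of "K (- v)"] v by (simp add: K)
    qed
    then show ?thesis
      by (simp add: ld[symmetric] frechet_derivative_at[OF comp, symmetric] K)
  qed
  show "zariski_tangent (alg_boundary (Sx P x)) u = {v. (x' - x) \<bullet> v = 0}"
    unfolding alg_boundary_def zariski_tangent_def vanishing_ideal_zariski_closure d_def[symmetric]
  proof (intro set_eqI iffI CollectI ballI)
    fix v p assume "v \<in> {v. d \<bullet> v = 0}" "p \<in> vanishing_ideal (frontier (Sx P x))"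
    then show "frechet_derivative p (at u) v = 0" using tangent by simp
  next
    fix v assume "v \<in> {v. \<forall>p\<in>vanishing_ideal (frontier (Sx P x)). frechet_derivative p (at u) v = 0}"
    then have v: "\<And>p. p \<in> vanishing_ideal (frontier (Sx P x)) \<Longrightarrow> frechet_derivative p (at u) v = 0"
      by blast
    \<comment> \<open>The determinant of I - A(c), moved to the target space by \<open>K\<close>,
      supplies a member of the ideal whose differential at \<open>u\<close> is nonzero.\<close>
    define p0 where "p0 c = det (mat 1 - Amat P c)" for c
    have p0: "p0 \<in> polyfun"
      unfolding p0_def[abs_def]
      by (intro polyfun_det)
        (simp add: Amat_entry polyfun_diff polyfun_sum pf_mult pf_const polyfun_component)
    have p00: "p0 c = 0" if "c \<in> frontier (Sed P)" for c
    proof -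
      obtain z where "z \<noteq> 0" "(mat 1 - Amat P c) *v z = 0"
        using \<open>c \<in> frontier (Sed P)\<close> unfolding frontier_Sed[OF P]
        by (auto simp: matrix_vector_mult_diff_rdistrib)
      then show ?thesis unfolding p0_def
        by (metis invertible_det_nz invertible_left_inverse matrix_left_invertible_ker)
    qed
    obtain c where c: "c \<noteq> 0"
      "((\<lambda>s. det (mat 1 - (1 + s) *\<^sub>R Amat P l)) has_real_derivative c) (at 0)"
      using det_derivative_nonzero[of "Amat P l" d] Amat_sym[OF P] d0 l ker by (auto simp: d_def)
    have "frechet_derivative p0 (at l) l = c"
      using c(2) by (intro frechet_scaled p0) (simp add: p0_def linear_cmul[OF linear_Amat])
    define p where "p y = p0 (K (x - y))" for y
    have K\<phi>: "K (x - \<phi> c) = c" for c by (simp add: \<phi>_def K)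
    have pp: "p \<in> polyfun"
      unfolding p_def[abs_def]
    proof (rule polyfun_compose[OF p0])
      fix b :: "real^'n"
      have "linear (\<lambda>y. K y \<bullet> b)"
        using K(1) by (intro linearI) (simp_all add: linear_add linear_cmul inner_add_left)
      moreover have "(\<lambda>y. K (x - y) \<bullet> b) = (\<lambda>y. K x \<bullet> b - K y \<bullet> b)"
        by (simp add: linear_diff[OF K(1)] inner_diff_left)
      ultimately show "(\<lambda>y. K (x - y) \<bullet> b) \<in> polyfun"
        by (simp add: polyfun_diff pf_const polyfun_linear)
    qed
    have pI: "p \<in> vanishing_ideal (frontier (Sx P x))"
      using pp p00 by (auto simp: vanishing_ideal_def frS p_def K\<phi>)
    have "((\<lambda>c. p (\<phi> c)) has_derivative (\<lambda>h. frechet_derivative p (at u) (- J h))) (at l)"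
      using has_derivative_compose[OF \<phi>_der, of p] polyfun_has_derivative[OF pp, of u] by (simp add: ul)
    then have "(p0 has_derivative (\<lambda>h. frechet_derivative p (at u) (- J h))) (at l)"
      by (simp add: p_def K\<phi>)
    then have nz: "frechet_derivative p (at u) (- J l) \<noteq> 0"
      using frechet_derivative_at c(1) \<open>frechet_derivative p0 (at l) l = c\<close> by metis
    define D where "D = frechet_derivative p (at u)"
    have linD: "linear D"
      unfolding D_def using polyfun_differentiable[OF pp] by (rule linear_frechet_derivative)
    have dl: "d \<bullet> (- J l) = (d \<bullet> d) / 2" using dJ[of l] l by (simp add: d_def)
    have dl0: "d \<bullet> J l \<noteq> 0"
    proof
      assume "d \<bullet> J l = 0"
      then show False using dl d0 by simp
    qed
    \<comment> \<open>Since d . (- J l) = (d . d) / 2 is nonzero, v splits into r (- J l) plus a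
      vector orthogonal to d. The differential of \<open>p\<close> kills the latter but not - J l,
      so r = 0.\<close>
    define r where "r = (d \<bullet> v) / (d \<bullet> (- J l))"
    have "d \<bullet> (v - r *\<^sub>R (- J l)) = 0"
      using dl0 by (simp add: r_def inner_diff_right inner_add_right)
    then have "D (v - r *\<^sub>R (- J l)) = 0" using tangent[OF pI] by (simp add: D_def)
    then have "D v = r * D (- J l)" by (simp only: linear_diff[OF linD] linear_cmul[OF linD]) simp
    moreover have "D v = 0" using v[OF pI] by (simp add: D_def)
    ultimately have "r = 0" using nz by (simp add: D_def)
    then show "d \<bullet> v = 0" using dl0 by (simp add: r_def)
  qed
qed

theorem theorem4p5:
  shows "generic_qdata (\<lambda>P::'n::finite qdata.
           \<forall>x\<in>Vf P. \<forall>x'\<in>Vf P. x \<noteq> x' \<longrightarrow>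
             (\<exists>u::real^'n. meet_tangentially
                {bisector x x', alg_boundary (Sx P x), alg_boundary (Sx P x')} u))"
proof -
  \<comment> \<open>Any index will do: A_m only serves to produce a boundary point from which
    vanishing is spread.\<close>
  define m :: 'n where "m = undefined"
  note generic = generic_conj[OF generic_jacobian generic_conj[OF generic_columns
        generic_conj[OF generic_corank generic_conj[OF generic_eigen_columns[of m]
            generic_simple_eigenvalue[of m]]]]]
  show ?thesis
  proof (rule generic_mono[OF generic], elim conjE, intro ballI impI)
    fix P :: "'n qdata" and x x'
    assume P: "symmetric_data P"
      and Jac: "\<forall>x\<in>Vf P. \<forall>c::real^'n. (\<Sum>j\<in>UNIV. c $ j *\<^sub>R Bvec P x j) = 0 \<longrightarrow> c = 0"
      and col: "\<forall>x\<in>Vf P. \<forall>x'\<in>Vf P. x \<noteq> x' \<longrightarrow> (\<forall>c. Amat P c *v (x' - x) = 0 \<longrightarrow> c = 0)"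
      and ker: "\<forall>x\<in>Vf P. \<forall>x'\<in>Vf P. x \<noteq> x' \<longrightarrow> (\<forall>c w. Amat P c *v (x' - x) = x' - x \<longrightarrow>
        Amat P c *v w = w \<longrightarrow> (\<exists>s. w = s *\<^sub>R (x' - x)))"
      and E: "\<forall>v t c. v \<noteq> 0 \<longrightarrow> t \<noteq> 0 \<longrightarrow> qA P m *v v = t *\<^sub>R v \<longrightarrow> Amat P c *v v = 0 \<longrightarrow> c = 0"
      and S: "\<forall>v w t. v \<noteq> 0 \<longrightarrow> qA P m *v v = t *\<^sub>R v \<longrightarrow> qA P m *v w = t *\<^sub>R w \<longrightarrow> (\<exists>s. w = s *\<^sub>R v)"
      and x: "x \<in> Vf P" "x' \<in> Vf P" "x \<noteq> x'"
    define d where "d = x' - x"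
    have d0: "d \<noteq> 0" using x by (simp add: d_def)
    have det: "det (Lmat P d) \<noteq> 0"
      unfolding det_Lmat d_def using col[rule_format, OF x] by blast
    define l where "l = kernel_param P d"
    have l: "Amat P l *v (x' - x) = x' - x" using kernel_param_unique[OF det] by (simp add: l_def d_def)
    have l': "Amat P l *v (x - x') = x - x'"
      using arg_cong[OF l, of uminus] by (simp add: matrix_vector_mult_diff_distrib)
    define u where "u = x - (\<Sum>j\<in>UNIV. l $ j *\<^sub>R Bvec P x j)"
    \<comment> \<open>Moving the base point from x to x' adds d, while the correction term changes
      by A(l) d = d, so the two effects cancel.\<close>
    have u': "u = x' - (\<Sum>j\<in>UNIV. l $ j *\<^sub>R Bvec P x' j)"
    proof -
      have "(\<Sum>j\<in>UNIV. l $ j *\<^sub>R Bvec P x' j) - (\<Sum>j\<in>UNIV. l $ j *\<^sub>R Bvec P x j) = Amat P l *v (x' - x)"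
        by (simp add: Amat_mult Bvec_def matrix_vector_mult_diff_distrib algebra_simps flip: sum_subtractf)
      then have "(\<Sum>j\<in>UNIV. l $ j *\<^sub>R Bvec P x' j) - (\<Sum>j\<in>UNIV. l $ j *\<^sub>R Bvec P x j) = x' - x"
        by (simp only: l)
      then show ?thesis by (simp add: u_def algebra_simps)
    qed
    have T1: "u \<in> alg_boundary (Sx P x)" "zariski_tangent (alg_boundary (Sx P x)) u = {v. d \<bullet> v = 0}"
      using alg_boundary_Sx[OF P x bspec[OF Jac x(1)] mp[OF bspec[OF bspec[OF col x(1)] x(2)] x(3)]
          mp[OF bspec[OF bspec[OF ker x(1)] x(2)] x(3)] E S l u_def]
      by (simp_all only: d_def)
    have neg: "{v. (x - x') \<bullet> v = 0} = {v. d \<bullet> v = 0}"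
      by (auto simp: d_def inner_diff_left)
    have T2: "u \<in> alg_boundary (Sx P x')" "zariski_tangent (alg_boundary (Sx P x')) u = {v. d \<bullet> v = 0}"
      using alg_boundary_Sx[OF P x(2,1) x(3)[symmetric] bspec[OF Jac x(2)]
          mp[OF bspec[OF bspec[OF col x(2)] x(1)] x(3)[symmetric]]
          mp[OF bspec[OF bspec[OF ker x(2)] x(1)] x(3)[symmetric]] E S l' u']
      by (simp_all only: neg)
    have "d \<bullet> u = d \<bullet> x + (d \<bullet> d) / 2"
      using Bvec_difference[OF P x(1,2), of l] l by (simp add: u_def inner_diff_right d_def)
    then have du: "(x' - x) \<bullet> u = (x' \<bullet> x' - x \<bullet> x) / 2"
      by (simp add: d_def inner_diff_left inner_diff_right inner_commute field_simps)
    have T3: "u \<in> bisector x x'" "zariski_tangent (bisector x x') u = {v. d \<bullet> v = 0}"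
      using du zariski_tangent_hyperplane[OF du] by (simp_all add: bisector_eq d_def)
    show "\<exists>u. meet_tangentially {bisector x x', alg_boundary (Sx P x), alg_boundary (Sx P x')} u"
      using T1 T2 T3 dim_hyperplane[OF d0]
      by (intro exI[of _ u]) (auto simp: meet_tangentially_def smooth_hypersurface_point_def)
  qed
qed

end
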